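(* Let $K\subset\mathbb{R}^d$ be a $\mathcal{C}^{1+\alpha}$ self-conformal set (for some $\alpha>0$), generated by the IFS $\{S_j\}_{j=1}^N$, satisfying the open set condition, and let $\mu$ be the Gibbs measure on $K$. Then $K$ satisfies the maximal power law if and only if $\mu$ is a component-counting measure of $K$.
   Context: Self-conformal sets. Let $\alpha>0$ and let $V\subset\mathbb{R}^d$ be a nonempty open set. A conformal map $S:V\to\mathbb{R}^d$ (differentiable, with $S'(x)$ a nonzero scalar multiple of an orthogonal matrix for each $x\in V$; $|S'(x)|$ denotes its operator norm) is $\mathcal{C}^{1+\alpha}$ differentiable if there is $C>0$ with $\big||S'(x)|-|S'(y)|\big|\le C|x-y|^\alpha$ for all $x,y\in V$. An iterated function system (IFS) $\{S_j\}_{j=1}^N$ is a finite family of injective contractions; here each $S_j:V\to V$ is an injective conformal $\mathcal{C}^{1+\alpha}$ contraction, and its attractor $K\subset V$ is the unique nonempty compact set with $K=\bigcup_{j=1}^N S_j(K)$. Such a $K$ is called a $\mathcal{C}^{1+\alpha}$ self-conformal set. The open set condition (OSC): there is a bounded nonempty open set $U\subset V$ with $S_i(U)\subset U$ for all $i$ and $S_i(U)\cap S_j(U)=\emptyset$ for $i\ne j$. For a word $I=i_1\dots i_n\in\{1,\dots,N\}^n$, $n\ge 0$, put $S_I=S_{i_1}\circ\dots\circ S_{i_n}$ (the identity if $n=0$); the sets $K_I=S_I(K)$ are the cylinders of $K$. Gibbs measure. Let $s=\dim_H K(=\dim_B K)$. The Gibbs measure $\mu$ on $K$ is the image, under the coding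 map $\{1,\dots,N\}^{\mathbb{N}}\to K$, of the unique shift-invariant Borel probability measure $m$ for which there is a constant $C\ge1$ with $C^{-1}|S_I'(x)|^s\le m([I])\le C|S_I'(x)|^s$ for all finite words $I$ and all $x\in K$, where $[I]$ is the set of infinite words with prefix $I$. Counting components. For a metric space $(E,\rho)$ and $\delta>0$, points $x,y\in E$ are $\delta$-equivalent if there is a finite sequence $x=x_1,\dots,x_k=y$ in $E$ with $\rho(x_i,x_{i+1})\le\delta$ for $1\le i\le k-1$. The equivalence classes are the $\delta$-connected components of $E$, and $h_E(\delta)$ is their number. A compact metric space $E$ satisfies the maximal power law if $h_E(\delta)\asymp\delta^{-\dim_B E}$ as $\delta\to0$, i.e. there is $c\ge1$ with $c^{-1}\delta^{-\dim_B E}\le h_E(\delta)\le c\,\delta^{-\dim_B E}$ for all sufficiently small $\delta>0$, where $\dim_B$ is box dimension. A finite Borel measure $\mu$ on the attractor $K$ of an IFS is a component-counting measure of $K$ if there is a constant $M\ge1$ such that for every cylinder $R$ of $K$ there is $\delta_0=\delta_0(R)>0$ with $M^{-1}\mu(R)\delta^{-\dim_B K}\le h_R(\delta)\le M\mu(R)\delta^{-\dim_B K}$ for all $0<\delta<\delta_0$. *)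

theory Defs
  imports "HOL-Probability.Probability"
begin

section \<open>Conformal iterated function systems\<close>

definition deriv_norm :: "('a::euclidean_space \<Rightarrow> 'a) \<Rightarrow> 'a \<Rightarrow> real" where
  "deriv_norm f x = onorm (frechet_derivative f (at x))"

definition conformal_on :: "'a::euclidean_space set \<Rightarrow> ('a \<Rightarrow> 'a) \<Rightarrow> bool" where
  "conformal_on V f \<longleftrightarrow>
     (\<forall>x\<in>V. \<exists>r T. r \<noteq> 0 \<and> orthogonal_transformation T \<and>
        (f has_derivative (\<lambda>h. r *\<^sub>R T h)) (at x))"

definition C1_alpha_conformal_on ::
  "real \<Rightarrow> 'a::euclidean_space set \<Rightarrow> ('a \<Rightarrow> 'a) \<Rightarrow> bool" where
  "C1_alpha_conformal_on \<alpha> V f \<longleftrightarrow> conformal_on V f \<and>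
     (\<exists>C>0. \<forall>x\<in>V. \<forall>y\<in>V. \<bar>deriv_norm f x - deriv_norm f y\<bar> \<le> C * dist x y powr \<alpha>)"

text \<open>
  A map defined on \<open>V\<close> is represented by a total function; its values outside the open set \<open>V\<close>
  play no role.  The system is \<open>S 1, \<dots>, S N\<close>.
\<close>

definition self_conformal_ifs ::
  "real \<Rightarrow> 'a::euclidean_space set \<Rightarrow> nat \<Rightarrow> (nat \<Rightarrow> 'a \<Rightarrow> 'a) \<Rightarrow> bool" where
  "self_conformal_ifs \<alpha> V N S \<longleftrightarrow>
     0 < \<alpha> \<and> open V \<and> V \<noteq> {} \<and>
     (\<forall>j\<in>{1..N}. S j ` V \<subseteq> V \<and> inj_on (S j) V \<and> (\<exists>c<1. c-lipschitz_on V (S j)) \<and>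
        C1_alpha_conformal_on \<alpha> V (S j))"

text \<open>
  By Hutchinson's theorem a nonempty compact invariant subset of \<open>V\<close> is unique, so the
  following predicate determines the attractor.  It also forces \<open>N \<ge> 1\<close>.
\<close>

definition is_attractor ::
  "'a::euclidean_space set \<Rightarrow> nat \<Rightarrow> (nat \<Rightarrow> 'a \<Rightarrow> 'a) \<Rightarrow> 'a set \<Rightarrow> bool" where
  "is_attractor V N S K \<longleftrightarrow>
     K \<subseteq> V \<and> K \<noteq> {} \<and> compact K \<and> K = (\<Union>j\<in>{1..N}. S j ` K)"

definition open_set_condition ::
  "'a::euclidean_space set \<Rightarrow> nat \<Rightarrow> (nat \<Rightarrow> 'a \<Rightarrow> 'a) \<Rightarrow> bool" where
  "open_set_condition V N S \<longleftrightarrow>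
     (\<exists>U. open U \<and> bounded U \<and> U \<noteq> {} \<and> U \<subseteq> V \<and>
        (\<forall>i\<in>{1..N}. S i ` U \<subseteq> U) \<and>
        (\<forall>i\<in>{1..N}. \<forall>j\<in>{1..N}. i \<noteq> j \<longrightarrow> S i ` U \<inter> S j ` U = {}))"

definition word_map :: "(nat \<Rightarrow> 'a \<Rightarrow> 'a) \<Rightarrow> nat list \<Rightarrow> 'a \<Rightarrow> 'a" where
  "word_map S I = foldr (\<lambda>i f. S i \<circ> f) I id"

definition cylinders :: "nat \<Rightarrow> (nat \<Rightarrow> 'a \<Rightarrow> 'a) \<Rightarrow> 'a set \<Rightarrow> 'a set set" where
  "cylinders N S K = (\<lambda>I. word_map S I ` K) ` lists {1..N}"

section \<open>Hausdorff and box dimension\<close>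

text \<open>
  The boundedness requirements are needed because \<^const>\<open>diameter\<close> has no meaningful value on
  unbounded sets.
\<close>

definition hausdorff_premeasure :: "real \<Rightarrow> real \<Rightarrow> 'a::metric_space set \<Rightarrow> ennreal" where
  "hausdorff_premeasure t \<delta> E =
     (INF U\<in>{U :: nat \<Rightarrow> 'a set. (\<forall>i. bounded (U i) \<and> diameter (U i) \<le> \<delta>) \<and> E \<subseteq> (\<Union>i. U i)}.
        (\<Sum>i. ennreal (diameter (U i) powr t)))"

definition hausdorff_measure :: "real \<Rightarrow> 'a::metric_space set \<Rightarrow> ennreal" where
  "hausdorff_measure t E = (SUP \<delta>\<in>{0<..}. hausdorff_premeasure t \<delta> E)"

text \<open>
  Only exponents \<open>t > 0\<close> are used, which does not affect the infimum and avoids the convention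
  \<open>0 powr 0 = 0\<close>.  For subsets of a Euclidean space the set of exponents is nonempty, so the
  real infimum is the genuine one.
\<close>

definition hausdorff_dim :: "'a::metric_space set \<Rightarrow> real" where
  "hausdorff_dim E = Inf {t. 0 < t \<and> hausdorff_measure t E = 0}"

definition covering_number :: "real \<Rightarrow> 'a::metric_space set \<Rightarrow> nat" where
  "covering_number \<delta> E =
     (LEAST n. \<exists>F. finite F \<and> card F = n \<and> (\<forall>A\<in>F. bounded A \<and> diameter A \<le> \<delta>) \<and> E \<subseteq> \<Union>F)"

text \<open>
  The value is meaningful only if the limit exists, as it does for attractors with a Gibbs
  measure below.
\<close>

definition box_dim :: "'a::metric_space set \<Rightarrow> real" where
  "box_dim E = Lim (at_right 0) (\<lambda>\<delta>. ln (real (covering_number \<delta> E)) / ln (1 / \<delta>))"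

section \<open>Gibbs measure\<close>

text \<open>
  Infinite words over \<open>{1..N}\<close> are streams; \<open>stream_space (count_space {1..N})\<close> carries the
  product sigma-algebra, i.e. the Borel sigma-algebra of the product topology.
\<close>

definition word_cylinder :: "nat \<Rightarrow> nat list \<Rightarrow> nat stream set" where
  "word_cylinder N I = {\<omega> \<in> streams {1..N}. stake (length I) \<omega> = I}"

definition coding_map :: "(nat \<Rightarrow> 'a \<Rightarrow> 'a) \<Rightarrow> 'a set \<Rightarrow> nat stream \<Rightarrow> 'a" where
  "coding_map S K \<omega> = (THE x. \<forall>n. x \<in> word_map S (stake n \<omega>) ` K)"

definition symbolic_gibbs_measure ::
  "nat \<Rightarrow> (nat \<Rightarrow> 'a::euclidean_space \<Rightarrow> 'a) \<Rightarrow> 'a set \<Rightarrow> nat stream measure \<Rightarrow> bool" where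
  "symbolic_gibbs_measure N S K m \<longleftrightarrow>
     prob_space m \<and> sets m = sets (stream_space (count_space {1..N})) \<and>
     (\<forall>A\<in>sets m. measure m (stl -` A \<inter> space m) = measure m A) \<and>
     (\<exists>C\<ge>1. \<forall>I\<in>lists {1..N}. \<forall>x\<in>K.
        (1 / C) * deriv_norm (word_map S I) x powr hausdorff_dim K \<le> measure m (word_cylinder N I) \<and>
        measure m (word_cylinder N I) \<le> C * deriv_norm (word_map S I) x powr hausdorff_dim K)"

text \<open>
  The symbolic measure is unique: the two-sided bounds and the chain rule make any such measure
  ergodic, and any two of them are equivalent.
\<close>

definition is_gibbs_measure ::
  "nat \<Rightarrow> (nat \<Rightarrow> 'a::euclidean_space \<Rightarrow> 'a) \<Rightarrow> 'a set \<Rightarrow> 'a measure \<Rightarrow> bool" where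
  "is_gibbs_measure N S K \<mu> \<longleftrightarrow>
     (\<exists>m. symbolic_gibbs_measure N S K m \<and>
        \<mu> = distr m (restrict_space borel K) (coding_map S K))"

section \<open>Counting components\<close>

definition delta_step :: "real \<Rightarrow> 'a::metric_space set \<Rightarrow> ('a \<times> 'a) set" where
  "delta_step \<delta> E = {(x, y). x \<in> E \<and> y \<in> E \<and> dist x y \<le> \<delta>}"

definition delta_equiv :: "real \<Rightarrow> 'a::metric_space set \<Rightarrow> ('a \<times> 'a) set" where
  "delta_equiv \<delta> E = {(x, y). x \<in> E \<and> y \<in> E \<and> (x, y) \<in> (delta_step \<delta> E)\<^sup>*}"

definition component_count :: "'a::metric_space set \<Rightarrow> real \<Rightarrow> nat" where
  "component_count E \<delta> = card (E // delta_equiv \<delta> E)"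

definition maximal_power_law :: "'a::metric_space set \<Rightarrow> bool" where
  "maximal_power_law E \<longleftrightarrow>
     compact E \<and>
     (\<exists>c\<ge>1. \<forall>\<^sub>F \<delta> in at_right 0.
        (1 / c) * \<delta> powr (- box_dim E) \<le> real (component_count E \<delta>) \<and>
        real (component_count E \<delta>) \<le> c * \<delta> powr (- box_dim E))"

definition component_counting_measure ::
  "nat \<Rightarrow> (nat \<Rightarrow> 'a::euclidean_space \<Rightarrow> 'a) \<Rightarrow> 'a set \<Rightarrow> 'a measure \<Rightarrow> bool" where
  "component_counting_measure N S K \<mu> \<longleftrightarrow>
     finite_measure \<mu> \<and> sets \<mu> = sets (restrict_space borel K) \<and>
     (\<exists>M\<ge>1. \<forall>R\<in>cylinders N S K. \<exists>\<delta>\<^sub>0>0. \<forall>\<delta>. 0 < \<delta> \<and> \<delta> < \<delta>\<^sub>0 \<longrightarrow>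
        (1 / M) * measure \<mu> R * \<delta> powr (- box_dim K) \<le> real (component_count R \<delta>) \<and>
        real (component_count R \<delta>) \<le> M * measure \<mu> R * \<delta> powr (- box_dim K))"

end

theory Submission
  imports Defs "HOL-Library.Sublist" "HOL-Real_Asymp.Real_Asymp"
begin

text \<open>
  Write \<open>\<lambda>\<^sub>I\<close> for the derivative norm of \<open>S\<^sub>I = word_map S I\<close> at a base point in \<open>K\<close>.  The theorem holds
  because, up to constants independent of the word \<open>I\<close>, the map \<open>S\<^sub>I\<close> acts on \<open>K\<close> as a similarity of
  ratio \<open>\<lambda>\<^sub>I\<close>, while the cylinder \<open>S\<^sub>I(K)\<close> has mass comparable to \<open>\<lambda>\<^sub>I\<^sup>s\<close>, where \<open>s\<close> is both the
  exponent in the Gibbs property and the box dimension of \<open>K\<close>.  If \<open>S\<^sub>I\<close> scales distances by about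
  \<open>\<lambda>\<^sub>I\<close>, the number of \<open>\<delta>\<close>-components of \<open>S\<^sub>I(K)\<close> lies between the numbers of components of \<open>K\<close>
  at two scales comparable to \<open>\<delta> / \<lambda>\<^sub>I\<close>.  Under the maximal power law these are comparable to
  \<open>(\<delta> / \<lambda>\<^sub>I) powr (- s)\<close>, which is comparable to \<open>\<mu>(S\<^sub>I(K)) * \<delta> powr (- s)\<close>; this says
  that \<open>\<mu>\<close> counts components.  The converse is the special case of the cylinder \<open>K\<close> itself,
  which has mass one.

  Quasi-similarity (\<open>word_map_quasi_similarity\<close>) rests on bounded distortion: on a compact
  neighbourhood of \<open>K\<close> that all generators map into itself, the logarithm of the derivative norm of
  each generator is Hoelder continuous and orbits of two points approach each other geometrically,
  so \<open>|S\<^sub>I'(x)| / |S\<^sub>I'(y)|\<close> is bounded independently of \<open>I\<close> (\<open>bounded_distortion\<close>).  Upper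
  estimates then come from the mean value inequality on balls, lower ones from the fact that the image
  of a ball under \<open>S\<^sub>I\<close> contains a ball of comparable size (\<open>ball_subset_conformal_image\<close>).

  The open set condition enters only through a packing argument (\<open>cylinder_overlap_bounded\<close>):
  boundedly many incomparable cylinders of size about \<open>t\<close> meet a given ball of radius
  about \<open>t\<close>, since near each of them there is a ball of radius about \<open>t\<close> and these balls are
  disjoint.  Combined with the words at which \<open>\<lambda>\<close> first drops to \<open>t\<close>, whose word
  cylinders partition the symbol space, it gives that there are about \<open>t powr (- s)\<close> such words, hence
  \<open>box_dim K = s\<close> (\<open>box_dim_eq\<close>), and that the mass of \<open>S\<^sub>I(K)\<close>, which may exceed that of the
  word cylinder \<open>[I]\<close> because cylinders of \<open>K\<close> can intersect, still is at most a constant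
  times \<open>\<lambda>\<^sub>I\<^sup>s\<close> (\<open>measure_cylinder_le\<close>).
\<close>

section \<open>Conformal maps\<close>

text \<open>
  A conformal derivative scales every vector by the same factor, and this factor is its operator norm.
\<close>

lemma conformal_onE:
  assumes "conformal_on V f" "x \<in> V"
  obtains f' where "(f has_derivative f') (at x)" "\<And>h. norm (f' h) = deriv_norm f x * norm h"
    and "0 < deriv_norm f x"
proof -
  obtain r T where r: "r \<noteq> 0" and T: "orthogonal_transformation T"
    and d: "(f has_derivative (\<lambda>h. r *\<^sub>R T h)) (at x)"
    using assms unfolding conformal_on_def by blast
  have n: "norm (r *\<^sub>R T h) = \<bar>r\<bar> * norm h" for h
    using T by (simp add: orthogonal_transformation)
  have "onorm (\<lambda>h. r *\<^sub>R T h) = \<bar>r\<bar>"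
  proof (rule antisym)
    show "onorm (\<lambda>h. r *\<^sub>R T h) \<le> \<bar>r\<bar>"
      by (rule onorm_le) (simp add: n del: norm_scaleR)
    obtain b :: 'a where b: "b \<in> Basis" using nonempty_Basis by blast
    show "\<bar>r\<bar> \<le> onorm (\<lambda>h. r *\<^sub>R T h)"
      using onorm[OF has_derivative_bounded_linear[OF d], of b] b by (simp add: n del: norm_scaleR)
  qed
  moreover have "frechet_derivative f (at x) = (\<lambda>h. r *\<^sub>R T h)"
    using frechet_derivative_at[OF d] by simp
  ultimately have "deriv_norm f x = \<bar>r\<bar>"
    by (simp add: deriv_norm_def)
  with n r d show thesis
    by (intro that[of "\<lambda>h. r *\<^sub>R T h"]) auto
qed

lemma conformal_on_subset: "conformal_on V f \<Longrightarrow> W \<subseteq> V \<Longrightarrow> conformal_on W f"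
  by (auto simp: conformal_on_def)

lemma conformal_on_id: "conformal_on V id"
  unfolding conformal_on_def
  by (intro ballI exI[of _ 1] exI[of _ "\<lambda>x. x"]) 
     (auto simp: orthogonal_transformation_def linear_iff intro!: derivative_eq_intros)

lemma conformal_on_compose:
  assumes "conformal_on V f" "conformal_on W g" "f ` V \<subseteq> W"
  shows "conformal_on V (g \<circ> f)"
  unfolding conformal_on_def
proof
  fix x assume x: "x \<in> V"
  then have fx: "f x \<in> W" using assms by auto
  obtain r T where r: "r \<noteq> 0" and T: "orthogonal_transformation T"
    and d: "(f has_derivative (\<lambda>h. r *\<^sub>R T h)) (at x)"
    using assms x unfolding conformal_on_def by blast
  obtain r' T' where r': "r' \<noteq> 0" and T': "orthogonal_transformation T'"
    and d': "(g has_derivative (\<lambda>h. r' *\<^sub>R T' h)) (at (f x))"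
    using assms fx unfolding conformal_on_def by blast
  have "((g \<circ> f) has_derivative (\<lambda>h. (r' * r) *\<^sub>R (T' \<circ> T) h)) (at x)"
    using diff_chain_at[OF d d'] T' 
    by (simp add: o_def orthogonal_transformation_linear linear_cmul)
  moreover have "orthogonal_transformation (T' \<circ> T)"
    using T T' by (rule orthogonal_transformation_compose[rotated])
  ultimately show "\<exists>r T. r \<noteq> 0 \<and> orthogonal_transformation T \<and>
        ((g \<circ> f) has_derivative (\<lambda>h. r *\<^sub>R T h)) (at x)"
    using r r' by (metis mult_eq_0_iff)
qed

lemma deriv_norm_id: "deriv_norm (id :: 'a \<Rightarrow> 'a::euclidean_space) x = 1"
proof -
  have "frechet_derivative (id :: 'a \<Rightarrow> 'a) (at x) = (\<lambda>h. h)"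
    by (rule frechet_derivative_at[symmetric]) (auto simp: id_def intro!: derivative_eq_intros)
  then show ?thesis unfolding deriv_norm_def by (simp only: onorm_id)
qed

lemma deriv_norm_compose:
  assumes "conformal_on V f" "conformal_on W g" "f ` V \<subseteq> W" "x \<in> V"
  shows "deriv_norm (g \<circ> f) x = deriv_norm g (f x) * deriv_norm f x"
proof -
  have fx: "f x \<in> W" using assms by auto
  obtain f' where f: "(f has_derivative f') (at x)" "\<And>h. norm (f' h) = deriv_norm f x * norm h"
    using conformal_onE[OF assms(1,4)] by metis
  obtain g' where g: "(g has_derivative g') (at (f x))" "\<And>h. norm (g' h) = deriv_norm g (f x) * norm h"
    using conformal_onE[OF assms(2) fx] by metis
  obtain k where k: "((g \<circ> f) has_derivative k) (at x)" "\<And>h. norm (k h) = deriv_norm (g \<circ> f) x * norm h"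
    using conformal_onE[OF conformal_on_compose[OF assms(1-3)] assms(4)] by metis
  have "k = g' \<circ> f'"
    using has_derivative_unique[OF k(1) diff_chain_at[OF f(1) g(1)]] .
  moreover obtain b :: 'a where b: "b \<in> Basis" using nonempty_Basis by blast
  ultimately show ?thesis using k(2)[of b] f(2)[of b] g(2)[of "f' b"] by simp
qed

lemma conformal_on_dist_le:
  assumes "conformal_on X f" "convex X" "\<And>z. z \<in> X \<Longrightarrow> deriv_norm f z \<le> B" "x \<in> X" "y \<in> X"
  shows "dist (f x) (f y) \<le> B * dist x y"
proof -
  have "\<exists>f'. (f has_derivative f') (at z) \<and> onorm f' \<le> B" if z: "z \<in> X" for z
  proof -
    obtain f' where f: "(f has_derivative f') (at z)" "\<And>h. norm (f' h) = deriv_norm f z * norm h"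
      using conformal_onE[OF assms(1) z] by metis
    have "onorm f' \<le> deriv_norm f z" by (rule onorm_le) (simp add: f(2))
    with f(1) assms(3)[OF z] show ?thesis by force
  qed
  then obtain f' where "\<And>z. z \<in> X \<Longrightarrow> (f has_derivative f' z) (at z)" "\<And>z. z \<in> X \<Longrightarrow> onorm (f' z) \<le> B"
    by metis
  then show ?thesis
    using differentiable_bound[OF assms(2), of f f' B x y] assms(4,5)
    by (simp add: dist_norm has_derivative_at_withinI)
qed

text \<open>
  The local inverse has derivative norm at most \<open>1 / b\<close>.  The largest ball around \<open>f x\<close> inside the
  (open) image is convex, so the inverse maps it into a closed ball of radius \<open>R / b\<close>, where \<open>R\<close> is
  its radius.  If \<open>R < \<rho> * b\<close>, that closed ball is a compact part of the domain, its image is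
  closed, and so even the nearest boundary point of the image would be a value of \<open>f\<close>, which an open
  image excludes.
\<close>

lemma ball_subset_conformal_image:
  fixes f :: "'a::euclidean_space \<Rightarrow> 'a"
  assumes conf: "conformal_on (ball x \<rho>) f" and inj: "inj_on f (ball x \<rho>)"
    and b: "0 < b" "\<And>z. z \<in> ball x \<rho> \<Longrightarrow> b \<le> deriv_norm f z" and \<rho>: "0 < \<rho>"
  shows "ball (f x) (\<rho> * b) \<subseteq> f ` ball x \<rho>"
proof (rule ccontr)
  define Y where "Y = f ` ball x \<rho>"
  define g where "g = inv_into (ball x \<rho>) f"
  have gf: "g (f z) = z" if "z \<in> ball x \<rho>" for z
    using that inj by (simp add: g_def)
  have cont: "continuous_on (ball x \<rho>) f"
    using conf by (metis conformal_onE continuous_at_imp_continuous_on has_derivative_continuous)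
  have Y: "open Y" unfolding Y_def
    using cont inj by (intro invariance_of_domain) auto
  have fx: "f x \<in> Y" using \<rho> by (auto simp: Y_def)
  assume "\<not> ball (f x) (\<rho> * b) \<subseteq> f ` ball x \<rho>"
  then obtain q where q: "q \<in> - Y" "dist (f x) q < \<rho> * b"
    unfolding Y_def by (auto simp: subset_iff)
  have cl: "closed (- Y)" using Y by auto
  obtain p where p: "p \<in> - Y" "infdist (f x) (- Y) = dist (f x) p"
    using infdist_attains_inf[OF cl] q by blast
  define R where "R = dist (f x) p"
  have R0: "R > 0" using p fx by (auto simp: R_def)
  have Rle: "R < \<rho> * b" using infdist_le[OF q(1), of "f x"] q(2) p(2) by (simp add: R_def)
  have sub: "ball (f x) R \<subseteq> Y"
  proof
    fix y assume "y \<in> ball (f x) R"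
    then show "y \<in> Y" using infdist_le[of y "- Y" "f x"] p(2) by (force simp: R_def)
  qed
  have "\<exists>g'. (g has_derivative g') (at y) \<and> onorm g' \<le> 1 / b" if "y \<in> Y" for y
  proof -
    obtain z where z: "z \<in> ball x \<rho>" "y = f z" using \<open>y \<in> Y\<close> by (auto simp: Y_def)
    obtain f' where f: "(f has_derivative f') (at z)" "\<And>h. norm (f' h) = deriv_norm f z * norm h"
      "0 < deriv_norm f z" using conformal_onE[OF conf z(1)] by metis
    have lin: "linear f'" using f(1) by (rule has_derivative_linear)
    have "inj f'" using f(2,3) lin by (simp add: linear_injective_0) (metis mult_eq_0_iff norm_eq_zero less_irrefl)
    then obtain g' where g': "linear g'" "g' \<circ> f' = id" "f' \<circ> g' = id"
      by (metis lin linear_injective_isomorphism o_def eq_id_iff)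
    have "(g has_derivative g') (at (f z))"
      by (rule has_derivative_inverse_strong[OF _ z(1) cont gf f(1) g'(3)]) auto
    moreover have "onorm g' \<le> 1 / b"
    proof (rule onorm_le)
      fix k
      have "norm k = deriv_norm f z * norm (g' k)" using f(2)[of "g' k"] g'(3) by (metis comp_apply id_apply)
      moreover have "b * norm (g' k) \<le> deriv_norm f z * norm (g' k)"
        using b(2)[OF z(1)] by (rule mult_right_mono) simp
      ultimately show "norm (g' k) \<le> 1 / b * norm k" using b(1) by (simp add: field_simps)
    qed
    ultimately show ?thesis using z by auto
  qed
  then obtain g' where g': "\<And>y. y \<in> Y \<Longrightarrow> (g has_derivative g' y) (at y)"
    "\<And>y. y \<in> Y \<Longrightarrow> onorm (g' y) \<le> 1 / b" by metis
  have lip: "dist x (g y) \<le> R / b" if "y \<in> ball (f x) R" for y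
  proof -
    have "norm (g (f x) - g y) \<le> 1 / b * norm (f x - y)"
      using differentiable_bound[of "ball (f x) R" g g' "1/b" "f x" y] g' sub that R0
      by (auto intro: has_derivative_at_withinI simp: subset_iff)
    also have "\<dots> \<le> 1 / b * R" using that b(1) by (intro mult_left_mono) (auto simp: dist_norm)
    finally show ?thesis using gf[of x] \<rho> by (simp add: dist_norm)
  qed
  have "R / b < \<rho>" using Rle b(1) by (simp add: field_simps)
  then have cb: "cball x (R / b) \<subseteq> ball x \<rho>" by auto
  have "closed (f ` cball x (R / b))"
    using continuous_on_subset[OF cont cb] by (intro compact_imp_closed compact_continuous_image) auto
  moreover have "ball (f x) R \<subseteq> f ` cball x (R / b)"
  proof
    fix y assume y: "y \<in> ball (f x) R"
    then have "f (g y) = y" using sub by (auto simp: g_def Y_def f_inv_into_f)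
    then show "y \<in> f ` cball x (R / b)" using lip[OF y] by (metis image_eqI mem_cball)
  qed
  ultimately have "closure (ball (f x) R) \<subseteq> f ` cball x (R / b)" by (rule closure_minimal[rotated])
  then have "p \<in> f ` cball x (R / b)" using R0 by (auto simp: R_def)
  then show False using p(1) cb by (auto simp: Y_def)
qed

text \<open>
  If \<open>f y\<close> were too close to \<open>f x\<close>, it would have a preimage closer to \<open>x\<close> than \<open>y\<close>, by the
  preceding lemma for the ball of radius \<open>dist x y\<close>; this contradicts injectivity.
\<close>

lemma conformal_on_dist_ge:
  fixes f :: "'a::euclidean_space \<Rightarrow> 'a"
  assumes conf: "conformal_on (ball x \<rho>) f" and inj: "inj_on f (ball x \<rho>)"
    and b: "0 < b" "\<And>z. z \<in> ball x \<rho> \<Longrightarrow> b \<le> deriv_norm f z"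
    and y: "y \<in> ball x \<rho>"
  shows "b * dist x y \<le> dist (f x) (f y)"
proof (rule ccontr)
  assume neg: "\<not> ?thesis"
  define d where "d = dist x y"
  have d: "0 < d" "d < \<rho>" using neg y by (auto simp: d_def)
  have sub: "ball x d \<subseteq> ball x \<rho>" using d by auto
  have "ball (f x) (d * b) \<subseteq> f ` ball x d"
    using sub b d by (intro ball_subset_conformal_image conformal_on_subset[OF conf] inj_on_subset[OF inj]) auto
  moreover have "f y \<in> ball (f x) (d * b)" using neg by (simp add: d_def mult.commute)
  ultimately obtain z where "z \<in> ball x d" "f z = f y" by auto
  then have "y \<in> ball x d" using inj sub y by (metis inj_onD subsetD)
  then show False by (simp add: d_def)
qed

section \<open>Bounded distortion\<close>

lemma word_map_Nil [simp]: "word_map S [] = id"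
  by (simp add: word_map_def)

lemma word_map_Cons [simp]: "word_map S (i # I) = S i \<circ> word_map S I"
  by (simp add: word_map_def)

lemma word_map_append: "word_map S (I @ J) = word_map S I \<circ> word_map S J"
  by (induction I) auto

locale conformal_ifs =
  fixes \<alpha> :: real and V K :: "'a::euclidean_space set" and N :: nat and S :: "nat \<Rightarrow> 'a \<Rightarrow> 'a"
  assumes ifs: "self_conformal_ifs \<alpha> V N S" and attractor: "is_attractor V N S K"
begin

lemma alpha_pos: "0 < \<alpha>" and open_V: "open V"
  using ifs by (auto simp: self_conformal_ifs_def)

lemma K_sub_V: "K \<subseteq> V" and K_nonempty: "K \<noteq> {}" and compact_K: "compact K"
  and K_eq: "K = (\<Union>j\<in>{1..N}. S j ` K)"
  using attractor by (auto simp: is_attractor_def)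

lemma generator_conformal:
  assumes "j \<in> {1..N}"
  shows "S j ` V \<subseteq> V" "inj_on (S j) V" "conformal_on V (S j)" "S j ` K \<subseteq> K"
proof -
  show "S j ` V \<subseteq> V" "inj_on (S j) V" "conformal_on V (S j)"
    using assms ifs by (auto simp: self_conformal_ifs_def C1_alpha_conformal_on_def)
  show "S j ` K \<subseteq> K"
    using assms K_eq by blast
qed

lemma contraction_ratio:
  obtains c where "0 < c" "c < 1" "\<And>j. j \<in> {1..N} \<Longrightarrow> c-lipschitz_on V (S j)"
proof -
  obtain k where k: "\<And>j. j \<in> {1..N} \<Longrightarrow> k j < 1 \<and> (k j)-lipschitz_on V (S j)"
    using ifs unfolding self_conformal_ifs_def by metis
  \<comment> \<open>Including \<open>1/2\<close> makes the ratio positive, so that its real powers behave well.\<close>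
  define c where "c = Max (insert (1/2) (k ` {1..N}))"
  have "k j \<le> c" if "j \<in> {1..N}" for j unfolding c_def using that by (intro Max_ge) auto
  then have "\<And>j. j \<in> {1..N} \<Longrightarrow> c-lipschitz_on V (S j)" using k lipschitz_on_le by blast
  moreover have "1/2 \<le> c" unfolding c_def by (intro Max_ge) auto
  moreover have "c < 1" using k by (subst c_def, subst Max_less_iff) auto
  ultimately show thesis by (intro that[of c]) auto
qed

lemma word_map_conformal:
  assumes "I \<in> lists {1..N}"
  shows "word_map S I ` V \<subseteq> V \<and> inj_on (word_map S I) V \<and> conformal_on V (word_map S I) \<and>
    word_map S I ` K \<subseteq> K"
  using assms
proof (induction I)
  case Nil
  then show ?case by (auto simp: conformal_on_id[unfolded id_def])
next
  case (Cons i I)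
  note i = generator_conformal[OF Cons.hyps(1)]
  have "word_map S (i # I) ` V \<subseteq> V" "word_map S (i # I) ` K \<subseteq> K"
    using Cons.IH i unfolding word_map_Cons image_comp[symmetric] by blast+
  moreover have "inj_on (word_map S (i # I)) V"
    using Cons.IH i by (auto intro!: comp_inj_on intro: inj_on_subset)
  moreover have "conformal_on V (word_map S (i # I))"
    using Cons.IH i by (auto intro: conformal_on_compose)
  ultimately show ?case by blast
qed

lemma deriv_norm_word_append:
  assumes "I \<in> lists {1..N}" "J \<in> lists {1..N}" "x \<in> V"
  shows "deriv_norm (word_map S (I @ J)) x = deriv_norm (word_map S I) (word_map S J x) * deriv_norm (word_map S J) x"
  unfolding word_map_append
  using word_map_conformal[OF assms(1)] word_map_conformal[OF assms(2)] assms(3) by (intro deriv_norm_compose) auto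

lemma deriv_norm_word_pos: "I \<in> lists {1..N} \<Longrightarrow> x \<in> V \<Longrightarrow> 0 < deriv_norm (word_map S I) x"
  using word_map_conformal conformal_onE by metis

lemma word_contracts:
  assumes c: "0 < c" "\<And>j. j \<in> {1..N} \<Longrightarrow> c-lipschitz_on V (S j)"
    and "I \<in> lists {1..N}" "x \<in> V" "y \<in> V"
  shows "dist (word_map S I x) (word_map S I y) \<le> c ^ length I * dist x y"
  using assms(3)
proof (induction I)
  case (Cons i I)
  have "word_map S I x \<in> V" "word_map S I y \<in> V" using word_map_conformal[OF Cons.hyps(2)] assms by auto
  then have "dist (word_map S (i # I) x) (word_map S (i # I) y)
      \<le> c * dist (word_map S I x) (word_map S I y)"
    using lipschitz_onD[OF c(2)[OF Cons.hyps(1)]] by simp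
  also have "\<dots> \<le> c * (c ^ length I * dist x y)" using Cons.IH c(1) by (intro mult_left_mono) auto
  finally show ?case by (simp add: mult.assoc)
qed simp

definition nbhd :: "real \<Rightarrow> 'a set" where "nbhd \<epsilon> = (\<Union>x\<in>K. cball x \<epsilon>)"

lemma K_sub_nbhd: "0 \<le> \<epsilon> \<Longrightarrow> K \<subseteq> nbhd \<epsilon>"
  by (auto simp: nbhd_def)

lemma compact_nbhd: "0 < \<epsilon> \<Longrightarrow> compact (nbhd \<epsilon>)"
proof -
  assume "0 < \<epsilon>"
  moreover have "nbhd \<epsilon> = {x. infdist x K \<le> \<epsilon>}"
  proof (intro set_eqI iffI)
    fix x assume "x \<in> {x. infdist x K \<le> \<epsilon>}"
    moreover obtain y where "y \<in> K" "infdist x K = dist x y"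
      using infdist_attains_inf[OF compact_imp_closed[OF compact_K] K_nonempty] by blast
    ultimately show "x \<in> nbhd \<epsilon>" by (auto simp: nbhd_def dist_commute)
  next
    fix x assume "x \<in> nbhd \<epsilon>"
    then show "x \<in> {x. infdist x K \<le> \<epsilon>}"
      by (auto simp: nbhd_def dist_commute intro: infdist_le2)
  qed
  ultimately show ?thesis using compact_infdist_le[OF K_nonempty compact_K] by simp
qed

text \<open>
  Each map contracts the Euclidean distance between any two points of \<open>V\<close>, and \<open>K\<close> is invariant,
  so a point within \<open>\<epsilon>\<close> of \<open>K\<close> stays within \<open>\<epsilon>\<close> of \<open>K\<close>.
\<close>

lemma word_map_nbhd:
  assumes I: "I \<in> lists {1..N}" and sub: "nbhd \<epsilon> \<subseteq> V" and x: "x \<in> nbhd \<epsilon>"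
  shows "word_map S I x \<in> nbhd \<epsilon>"
proof -
  obtain c where c: "0 < c" "c < 1" "\<And>j. j \<in> {1..N} \<Longrightarrow> c-lipschitz_on V (S j)"
    using contraction_ratio by metis
  obtain k where k: "k \<in> K" "dist k x \<le> \<epsilon>" using x by (auto simp: nbhd_def)
  have "dist (word_map S I k) (word_map S I x) \<le> c ^ length I * dist k x"
    using c I k x sub K_sub_V by (intro word_contracts) auto
  also have "\<dots> \<le> 1 * dist k x" using c by (intro mult_right_mono power_le_one) auto
  finally show ?thesis using k word_map_conformal[OF I] by (force simp: nbhd_def)
qed

lemma deriv_norm_lower_bound:
  assumes e: "0 < \<epsilon>" "nbhd \<epsilon> \<subseteq> V"
  obtains a where "0 < a" "\<And>j x. j \<in> {1..N} \<Longrightarrow> x \<in> nbhd \<epsilon> \<Longrightarrow> a \<le> deriv_norm (S j) x"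
proof -
  have "\<exists>a>0. \<forall>x\<in>nbhd \<epsilon>. a \<le> deriv_norm (S j) x" if j: "j \<in> {1..N}" for j
  proof -
    obtain H where H: "0 < H" "\<And>x y. x \<in> V \<Longrightarrow> y \<in> V \<Longrightarrow>
        \<bar>deriv_norm (S j) x - deriv_norm (S j) y\<bar> \<le> H * dist x y powr \<alpha>"
      using ifs j unfolding self_conformal_ifs_def C1_alpha_conformal_on_def by blast
    have "continuous_on V (deriv_norm (S j))"
      unfolding continuous_on_def
    proof
      fix x assume x: "x \<in> V"
      have "((\<lambda>y. H * dist y x powr \<alpha>) \<longlongrightarrow> H * 0 powr \<alpha>) (at x within V)"
        using alpha_pos by (intro tendsto_intros tendsto_dist_iff[THEN iffD1]) (auto intro!: tendsto_eq_intros)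
      then have "((\<lambda>y. H * dist y x powr \<alpha>) \<longlongrightarrow> 0) (at x within V)" using alpha_pos by simp
      then have "((\<lambda>y. deriv_norm (S j) y - deriv_norm (S j) x) \<longlongrightarrow> 0) (at x within V)"
        by (rule Lim_null_comparison[rotated]) (auto simp: eventually_at_filter H x)
      then show "(deriv_norm (S j) \<longlongrightarrow> deriv_norm (S j) x) (at x within V)" by (rule LIM_zero_cancel)
    qed
    then have "continuous_on (nbhd \<epsilon>) (deriv_norm (S j))" using e(2) by (rule continuous_on_subset)
    moreover have "nbhd \<epsilon> \<noteq> {}" using K_sub_nbhd[of \<epsilon>] K_nonempty e by auto
    ultimately obtain x where "x \<in> nbhd \<epsilon>" "\<forall>y\<in>nbhd \<epsilon>. deriv_norm (S j) x \<le> deriv_norm (S j) y"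
      using continuous_attains_inf[OF compact_nbhd[OF e(1)]] by metis
    moreover from this(1) have "0 < deriv_norm (S j) x" using e(2) generator_conformal(3)[OF j] by (metis conformal_onE subsetD)
    ultimately show ?thesis by blast
  qed
  then obtain a where a: "\<And>j. j \<in> {1..N} \<Longrightarrow> 0 < a j \<and> (\<forall>x\<in>nbhd \<epsilon>. a j \<le> deriv_norm (S j) x)" by metis
  define b where "b = Min (insert 1 (a ` {1..N}))"
  have "0 < b" using a by (subst b_def, subst Min_gr_iff) auto
  moreover have "b \<le> a j" if "j \<in> {1..N}" for j unfolding b_def using that by (intro Min_le) auto
  ultimately show thesis using a by (intro that[of b]) force+
qed

text \<open>
  By the chain rule, \<open>|S\<^sub>I'(x)| / |S\<^sub>I'(y)|\<close> is a product of ratios of generator derivatives at two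
  points whose distance is at most \<open>c ^ k * \<Delta>\<close> after \<open>k\<close> steps.  Hoelder continuity and the
  uniform lower bound make the corresponding ratio at most \<open>1 + B * q ^ k\<close> with \<open>q = c powr \<alpha> < 1\<close>,
  so the product is bounded by the exponential of a geometric series.
\<close>

lemma bounded_distortion:
  assumes e: "0 < \<epsilon>" "nbhd \<epsilon> \<subseteq> V"
  obtains D where "1 \<le> D" "\<And>I x y. I \<in> lists {1..N} \<Longrightarrow> x \<in> nbhd \<epsilon> \<Longrightarrow> y \<in> nbhd \<epsilon> \<Longrightarrow>
    deriv_norm (word_map S I) x \<le> D * deriv_norm (word_map S I) y"
proof -
  obtain c where c: "0 < c" "c < 1" "\<And>j. j \<in> {1..N} \<Longrightarrow> c-lipschitz_on V (S j)"
    using contraction_ratio by metis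
  obtain a where a: "0 < a" "\<And>j x. j \<in> {1..N} \<Longrightarrow> x \<in> nbhd \<epsilon> \<Longrightarrow> a \<le> deriv_norm (S j) x"
    using deriv_norm_lower_bound[OF e] by metis
  obtain h where h: "\<And>j. j \<in> {1..N} \<Longrightarrow> 0 < h j \<and> (\<forall>x\<in>V. \<forall>y\<in>V.
        \<bar>deriv_norm (S j) x - deriv_norm (S j) y\<bar> \<le> h j * dist x y powr \<alpha>)"
    using ifs unfolding self_conformal_ifs_def C1_alpha_conformal_on_def by metis
  define H where "H = Max (insert 1 (h ` {1..N}))"
  have H1: "1 \<le> H" by (simp add: H_def)
  have H: "\<bar>deriv_norm (S j) x - deriv_norm (S j) y\<bar> \<le> H * dist x y powr \<alpha>"
    if "j \<in> {1..N}" "x \<in> V" "y \<in> V" for j x y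
  proof -
    have "h j \<le> H" unfolding H_def using that by (intro Max_ge) auto
    then have "h j * dist x y powr \<alpha> \<le> H * dist x y powr \<alpha>" by (intro mult_right_mono) auto
    then show ?thesis using h[OF that(1)] that(2,3) by force
  qed
  define \<Delta> where "\<Delta> = diameter (nbhd \<epsilon>)"
  have \<Delta>: "dist x y \<le> \<Delta>" if "x \<in> nbhd \<epsilon>" "y \<in> nbhd \<epsilon>" for x y
    unfolding \<Delta>_def using compact_nbhd[OF e(1)] that by (intro diameter_bounded_bound compact_imp_bounded)
  have \<Delta>0: "0 \<le> \<Delta>" unfolding \<Delta>_def using compact_nbhd[OF e(1)] by (intro diameter_ge_0 compact_imp_bounded)
  define q where "q = c powr \<alpha>"
  have q: "0 < q" "q < 1" using c alpha_pos powr_less_mono2[of \<alpha> c 1] by (auto simp: q_def)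
  define B where "B = H / a * \<Delta> powr \<alpha>"
  have B0: "0 \<le> B" using H1 a(1) by (simp add: B_def)
  have main: "deriv_norm (word_map S I) x \<le> exp (B * (\<Sum>k<length I. q ^ k)) * deriv_norm (word_map S I) y"
    if "I \<in> lists {1..N}" "x \<in> nbhd \<epsilon>" "y \<in> nbhd \<epsilon>" for I x y
    using that(1)
  proof (induction I)
    case Nil
    then show ?case by (simp add: deriv_norm_id[unfolded id_def])
  next
    case (Cons i I)
    define x' y' where "x' = word_map S I x" and "y' = word_map S I y"
    have n: "x' \<in> nbhd \<epsilon>" "y' \<in> nbhd \<epsilon>"
      using word_map_nbhd[OF Cons.hyps(2) e(2)] that by (auto simp: x'_def y'_def)
    have "dist x' y' \<le> c ^ length I * dist x y"
      unfolding x'_def y'_def using that e(2) c Cons.hyps(2) by (intro word_contracts) auto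
    also have "\<dots> \<le> c ^ length I * \<Delta>" using c \<Delta> that by (intro mult_left_mono) auto
    finally have "dist x' y' powr \<alpha> \<le> (c ^ length I * \<Delta>) powr \<alpha>"
      using alpha_pos by (intro powr_mono2) auto
    also have "\<dots> = q ^ length I * \<Delta> powr \<alpha>"
      using c(1) \<Delta>0 by (simp add: powr_mult q_def powr_realpow[symmetric] powr_powr mult.commute)
    finally have d: "dist x' y' powr \<alpha> \<le> q ^ length I * \<Delta> powr \<alpha>" .
    have ay: "a \<le> deriv_norm (S i) y'" using a n Cons.hyps by auto
    have "deriv_norm (S i) x' \<le> deriv_norm (S i) y' + H * dist x' y' powr \<alpha>"
      using H[OF Cons.hyps(1), of x' y'] subsetD[OF e(2) n(1)] subsetD[OF e(2) n(2)] by linarith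
    also have "\<dots> \<le> deriv_norm (S i) y' + H * (q ^ length I * \<Delta> powr \<alpha>)"
      using d H1 by (intro add_mono mult_left_mono) auto
    also have "\<dots> = deriv_norm (S i) y' + (B * q ^ length I) * a"
      using a(1) by (simp add: B_def)
    also have "\<dots> \<le> deriv_norm (S i) y' + (B * q ^ length I) * deriv_norm (S i) y'"
      using ay B0 q by (intro add_mono mult_left_mono) auto
    also have "\<dots> = (1 + B * q ^ length I) * deriv_norm (S i) y'" by (simp add: algebra_simps)
    also have "\<dots> \<le> exp (B * q ^ length I) * deriv_norm (S i) y'"
      using ay a(1) by (intro mult_right_mono) auto
    finally have s: "deriv_norm (S i) x' \<le> exp (B * q ^ length I) * deriv_norm (S i) y'" .
    have w: "word_map S I ` V \<subseteq> V" "conformal_on V (word_map S I)" using word_map_conformal[OF Cons.hyps(2)] by auto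
    have comp: "deriv_norm (word_map S (i # I)) z = deriv_norm (S i) (word_map S I z) * deriv_norm (word_map S I) z"
      if "z \<in> V" for z
      using deriv_norm_compose[OF w(2) generator_conformal(3)[OF Cons.hyps(1)] w(1) that] by simp
    have "deriv_norm (word_map S (i # I)) x = deriv_norm (S i) x' * deriv_norm (word_map S I) x"
      using comp that e(2) by (auto simp: x'_def)
    also have "\<dots> \<le> (exp (B * q ^ length I) * deriv_norm (S i) y') *
        (exp (B * (\<Sum>k<length I. q ^ k)) * deriv_norm (word_map S I) y)"
      using s Cons.IH ay a(1) deriv_norm_word_pos[OF Cons.hyps(2), of x] that e(2)
      by (intro mult_mono) auto
    also have "\<dots> = exp (B * q ^ length I + B * (\<Sum>k<length I. q ^ k)) * deriv_norm (word_map S (i # I)) y"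
      using comp that e(2) by (auto simp: y'_def exp_add)
    finally show ?case by (simp add: algebra_simps o_def)
  qed
  define D where "D = exp (B * (1 / (1 - q)))"
  show thesis
  proof (rule that[of D])
    show "1 \<le> D" using B0 q by (simp add: D_def)
    fix I x y assume I: "I \<in> lists {1..N}" "x \<in> nbhd \<epsilon>" "y \<in> nbhd \<epsilon>"
    have "(\<Sum>k<length I. q ^ k) \<le> (\<Sum>k. q ^ k)" using q by (intro sum_le_suminf summable_geometric) auto
    then have "(\<Sum>k<length I. q ^ k) \<le> 1 / (1 - q)" using q by (simp add: suminf_geometric)
    then have "exp (B * (\<Sum>k<length I. q ^ k)) \<le> D" 
      unfolding D_def exp_le_cancel_iff using B0 by (intro mult_left_mono) auto
    then show "deriv_norm (word_map S I) x \<le> D * deriv_norm (word_map S I) y"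
      using main[OF I] deriv_norm_word_pos[OF I(1), of y] I(3) e(2)
      by (meson mult_right_mono less_imp_le order_trans subsetD)
  qed
qed

end

section \<open>Quasi-similarity and bounded overlap of cylinders\<close>

text \<open>
  Compare volumes.
\<close>

lemma card_disjoint_balls_le:
  fixes p :: "'i \<Rightarrow> 'a::euclidean_space"
  assumes W: "finite W" and r: "0 < r" and R: "0 < R"
    and disj: "\<And>i j. i \<in> W \<Longrightarrow> j \<in> W \<Longrightarrow> i \<noteq> j \<Longrightarrow> ball (p i) r \<inter> ball (p j) r = {}"
    and sub: "\<And>i. i \<in> W \<Longrightarrow> ball (p i) r \<subseteq> ball q R"
  shows "real (card W) \<le> (R / r) ^ DIM('a)"
proof -
  define v where "v = unit_ball_vol (real DIM('a))"
  have v: "0 < v" by (simp add: v_def)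
  have ball: "measure lebesgue (ball x s) = v * s ^ DIM('a)" if "0 < s" for x :: 'a and s
    using that content_ball[of s x] by (simp add: v_def)
  have "real (card W) * (v * r ^ DIM('a)) = (\<Sum>i\<in>W. measure lebesgue (ball (p i) r))"
    using ball[OF r] by simp
  also have "\<dots> = measure lebesgue (\<Union>i\<in>W. ball (p i) r)"
    using disj by (intro measure_UNION'[symmetric] W) (auto simp: pairwise_def disjnt_def)
  also have "\<dots> \<le> measure lebesgue (ball q R)"
    using sub W by (intro measure_mono_fmeasurable) auto
  also have "\<dots> = v * R ^ DIM('a)" using ball[OF R] .
  finally show ?thesis using v r by (simp add: field_simps power_divide)
qed

text \<open>
  From here on a neighbourhood size \<open>\<epsilon>\<close>, a distortion constant \<open>D\<close> and the base point at which \<open>lam\<close>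
  measures derivatives are fixed.
\<close>

locale conformal_ifs_with_distortion = conformal_ifs +
  fixes \<epsilon> D :: real and x0 :: 'a
  assumes eps: "0 < \<epsilon>" "nbhd \<epsilon> \<subseteq> V" and D1: "1 \<le> D" and x0: "x0 \<in> K"
    and distortion: "\<And>I x y. I \<in> lists {1..N} \<Longrightarrow> x \<in> nbhd \<epsilon> \<Longrightarrow> y \<in> nbhd \<epsilon> \<Longrightarrow>
      deriv_norm (word_map S I) x \<le> D * deriv_norm (word_map S I) y"
begin

definition lam :: "nat list \<Rightarrow> real" where "lam I = deriv_norm (word_map S I) x0"

lemma x0_nbhd: "x0 \<in> nbhd \<epsilon>"
  using x0 K_sub_nbhd[of \<epsilon>] eps by auto

lemma lam_pos: "I \<in> lists {1..N} \<Longrightarrow> 0 < lam I"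
  unfolding lam_def using x0 K_sub_V by (intro deriv_norm_word_pos) auto

lemma lam_Nil: "lam [] = 1"
  by (simp add: lam_def deriv_norm_id)

lemma dist_word_map_le_local:
  assumes I: "I \<in> lists {1..N}" and x: "x \<in> K" and y: "dist x y \<le> \<epsilon>"
  shows "dist (word_map S I x) (word_map S I y) \<le> D * lam I * dist x y"
proof (rule conformal_on_dist_le[where X = "cball x \<epsilon>"])
  have sub: "cball x \<epsilon> \<subseteq> nbhd \<epsilon>" using x by (auto simp: nbhd_def)
  show "conformal_on (cball x \<epsilon>) (word_map S I)"
    using word_map_conformal[OF I] sub eps by (meson conformal_on_subset subset_trans)
  show "deriv_norm (word_map S I) z \<le> D * lam I" if "z \<in> cball x \<epsilon>" for z
    unfolding lam_def using that sub by (intro distortion I x0_nbhd) auto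
qed (use y eps in auto)

lemma ball_subset_word_map_image:
  assumes I: "I \<in> lists {1..N}" and sub: "ball z \<rho> \<subseteq> nbhd \<epsilon>" and \<rho>: "0 < \<rho>"
  shows "ball (word_map S I z) (\<rho> * (lam I / D)) \<subseteq> word_map S I ` ball z \<rho>"
proof (rule ball_subset_conformal_image)
  have V: "ball z \<rho> \<subseteq> V" using sub eps by simp
  show "conformal_on (ball z \<rho>) (word_map S I)"
    using word_map_conformal[OF I] V by (meson conformal_on_subset)
  show "inj_on (word_map S I) (ball z \<rho>)"
    using word_map_conformal[OF I] V by (meson inj_on_subset)
  show "lam I / D \<le> deriv_norm (word_map S I) y" if "y \<in> ball z \<rho>" for y
    using distortion[OF I x0_nbhd, of y] that sub D1 by (auto simp: lam_def field_simps)
qed (use \<rho> D1 lam_pos[OF I] in auto)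

text \<open>
  Each further letter costs at most the factor \<open>a / D\<close>: the smallest derivative of a generator near
  \<open>K\<close>, corrected by the distortion caused by moving the base point.
\<close>

lemma lam_append_ge:
  obtains \<kappa> where "0 < \<kappa>" "\<kappa> \<le> 1"
    "\<And>I J. I \<in> lists {1..N} \<Longrightarrow> J \<in> lists {1..N} \<Longrightarrow> \<kappa> ^ length J * lam I \<le> lam (I @ J)"
proof -
  obtain a where a: "0 < a" "\<And>j x. j \<in> {1..N} \<Longrightarrow> x \<in> nbhd \<epsilon> \<Longrightarrow> a \<le> deriv_norm (S j) x"
    using deriv_norm_lower_bound[OF eps] by metis
  define \<kappa> where "\<kappa> = min 1 (a / D)"
  have \<kappa>: "0 < \<kappa>" "\<kappa> \<le> 1" "\<kappa> \<le> a / D" using a D1 by (auto simp: \<kappa>_def)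
  have "\<kappa> ^ length J * lam I \<le> lam (I @ J)" if I: "I \<in> lists {1..N}" and J: "J \<in> lists {1..N}" for I J
    using J
  proof (induction J rule: rev_induct)
    case (snoc j J)
    then have j: "j \<in> {1..N}" and IJ: "I @ J \<in> lists {1..N}" using I by auto
    have jx: "S j x0 \<in> nbhd \<epsilon>" using word_map_nbhd[of "[j]" \<epsilon> x0] j eps x0_nbhd by simp
    have "\<kappa> ^ length (J @ [j]) * lam I \<le> \<kappa> * lam (I @ J)"
      using snoc \<kappa>(1) by (simp add: mult.assoc mult_left_mono)
    also have "\<dots> \<le> a / D * lam (I @ J)" using \<kappa> lam_pos[OF IJ] by (intro mult_right_mono) auto
    also have "\<dots> \<le> a * deriv_norm (word_map S (I @ J)) (S j x0)"
      using distortion[OF IJ x0_nbhd jx] a(1) D1 by (simp add: lam_def field_simps)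
    also have "\<dots> \<le> deriv_norm (S j) x0 * deriv_norm (word_map S (I @ J)) (S j x0)"
      using a(2)[OF j x0_nbhd] deriv_norm_word_pos[OF IJ, of "S j x0"] jx eps
      by (intro mult_right_mono) auto
    also have "\<dots> = lam (I @ J @ [j])"
      using deriv_norm_word_append[OF IJ, of "[j]" x0] j x0 K_sub_V by (auto simp: lam_def)
    finally show ?case .
  qed simp
  with \<kappa> show thesis using that by blast
qed

text \<open>
  The image of the \<open>\<epsilon>\<close>-ball at \<open>x0\<close> contains a ball of radius comparable to \<open>lam I\<close> and is contained
  in one of radius \<open>c ^ length I * \<epsilon>\<close>; comparing the two radii gives the bound.
\<close>

lemma lam_le_power:
  assumes c: "0 < c" "\<And>j. j \<in> {1..N} \<Longrightarrow> c-lipschitz_on V (S j)" and I: "I \<in> lists {1..N}"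
  shows "lam I \<le> D * c ^ length I"
proof -
  have sub: "ball x0 \<epsilon> \<subseteq> nbhd \<epsilon>" using x0 by (force simp: nbhd_def)
  have "word_map S I ` ball x0 \<epsilon> \<subseteq> cball (word_map S I x0) (c ^ length I * \<epsilon>)"
  proof (clarsimp)
    fix y assume y: "dist x0 y < \<epsilon>"
    then have "dist (word_map S I x0) (word_map S I y) \<le> c ^ length I * dist x0 y"
      using word_contracts[OF c I, of x0 y] x0 K_sub_V sub eps by (auto simp: subset_iff)
    also have "\<dots> \<le> c ^ length I * \<epsilon>" using y c by (intro mult_left_mono) auto
    finally show "dist (word_map S I x0) (word_map S I y) \<le> c ^ length I * \<epsilon>" .
  qed
  with ball_subset_word_map_image[OF I sub eps(1)]
  have "ball (word_map S I x0) (\<epsilon> * (lam I / D)) \<subseteq> cball (word_map S I x0) (c ^ length I * \<epsilon>)"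
    by (rule subset_trans)
  then have "\<epsilon> * (lam I / D) \<le> c ^ length I * \<epsilon>"
    using c(1) eps(1) by (auto simp: ball_subset_cball_iff intro: order_trans[of _ 0])
  then show ?thesis using eps(1) D1 by (simp add: field_simps)
qed

text \<open>
  The mean value inequality controls only points of \<open>K\<close> at distance at most \<open>\<epsilon>\<close>, as \<open>V\<close> may not
  contain a path between distant points.  For an upper bound at arbitrary points, apply the last \<open>n0\<close>
  letters of the word first: they bring all of \<open>K\<close> within diameter \<open>\<epsilon>\<close> and change \<open>lam\<close> by a
  bounded factor.  For the lower bound, nearby points are handled by \<open>conformal_on_dist_ge\<close>, and distant
  points have images outside the ball that the image of the \<open>\<epsilon>\<close>-ball contains.
\<close>

lemma word_map_quasi_similarity:
  obtains L where "1 \<le> L"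
    "\<And>I x y. I \<in> lists {1..N} \<Longrightarrow> x \<in> K \<Longrightarrow> y \<in> K \<Longrightarrow>
      dist (word_map S I x) (word_map S I y) \<le> L * lam I * dist x y"
    "\<And>I x y. I \<in> lists {1..N} \<Longrightarrow> x \<in> K \<Longrightarrow> y \<in> K \<Longrightarrow>
      lam I * dist x y \<le> L * dist (word_map S I x) (word_map S I y)"
proof -
  obtain c where c: "0 < c" "c < 1" "\<And>j. j \<in> {1..N} \<Longrightarrow> c-lipschitz_on V (S j)"
    using contraction_ratio by metis
  obtain \<kappa> where \<kappa>: "0 < \<kappa>" "\<kappa> \<le> 1"
    "\<And>I J. I \<in> lists {1..N} \<Longrightarrow> J \<in> lists {1..N} \<Longrightarrow> \<kappa> ^ length J * lam I \<le> lam (I @ J)"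
    using lam_append_ge by metis
  define \<Delta> where "\<Delta> = diameter K + 1"
  have \<Delta>: "0 < \<Delta>" "\<And>x y. x \<in> K \<Longrightarrow> y \<in> K \<Longrightarrow> dist x y \<le> \<Delta>"
    using diameter_ge_0[OF compact_imp_bounded[OF compact_K]]
      diameter_bounded_bound[OF compact_imp_bounded[OF compact_K]] by (force simp: \<Delta>_def)+
  have "(\<lambda>n. c ^ n * \<Delta>) \<longlonglongrightarrow> 0"
    using c by (intro tendsto_mult_left_zero LIMSEQ_realpow_zero) auto
  then have "eventually (\<lambda>n. c ^ n * \<Delta> < \<epsilon>) sequentially" using eps(1) by (rule order_tendstoD)
  then obtain n0 where n0: "c ^ n0 * \<Delta> < \<epsilon>" by (auto simp: eventually_sequentially)
  define L where "L = max (D / \<kappa> ^ n0) (max D (D * \<Delta> / \<epsilon>))"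
  have L: "D / \<kappa> ^ n0 \<le> L" "D \<le> L" "D * \<Delta> / \<epsilon> \<le> L" by (auto simp: L_def)
  have upper: "dist (word_map S I x) (word_map S I y) \<le> L * lam I * dist x y"
    if I: "I \<in> lists {1..N}" and xy: "x \<in> K" "y \<in> K" for I x y
  proof -
    \<comment> \<open>\<open>J\<close> consists of the last \<open>n0\<close> letters, or of the whole word if it is shorter.\<close>
    define I' J where "I' = take (length I - n0) I" and "J = drop (length I - n0) I"
    have IJ: "I = I' @ J" by (simp add: I'_def J_def)
    then have l: "I' \<in> lists {1..N}" "J \<in> lists {1..N}" using I by auto
    have lJ: "length J \<le> n0" by (simp add: J_def)
    have Jx: "word_map S J x \<in> K" "word_map S J y \<in> K" using word_map_conformal[OF l(2)] xy by auto
    have con: "dist (word_map S J x) (word_map S J y) \<le> c ^ length J * dist x y"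
      using word_contracts[OF c(1,3) l(2)] xy K_sub_V by auto
    also have "\<dots> \<le> 1 * dist x y" using c by (intro mult_right_mono power_le_one) auto
    finally have le: "dist (word_map S J x) (word_map S J y) \<le> dist x y" by simp
    have *: "dist (word_map S I x) (word_map S I y) \<le> D * lam I' * dist (word_map S J x) (word_map S J y)"
    proof (cases "I' = []")
      case True
      then show ?thesis using D1 by (simp add: IJ lam_Nil mult_le_cancel_right1)
    next
      case False
      then have "length J = n0" by (auto simp: I'_def J_def)
      then have "dist (word_map S J x) (word_map S J y) \<le> c ^ n0 * dist x y" using con by simp
      also have "\<dots> \<le> c ^ n0 * \<Delta>" using c \<Delta> xy by (intro mult_left_mono) auto
      finally have "dist (word_map S J x) (word_map S J y) \<le> \<epsilon>" using n0 by simp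
      from dist_word_map_le_local[OF l(1) Jx(1) this] show ?thesis
        by (simp add: IJ word_map_append)
    qed
    have "\<kappa> ^ n0 * lam I' \<le> \<kappa> ^ length J * lam I'"
      using \<kappa> lJ lam_pos[OF l(1)] by (intro mult_right_mono power_decreasing) auto
    also have "\<dots> \<le> lam I" using \<kappa>(3)[OF l] IJ by simp
    finally have "lam I' \<le> lam I / \<kappa> ^ n0" using \<kappa>(1) by (simp add: field_simps)
    then have "D * lam I' \<le> D / \<kappa> ^ n0 * lam I" 
      using D1 mult_left_mono[of "lam I'" "lam I / \<kappa> ^ n0" D] by simp
    also have "\<dots> \<le> L * lam I" using L(1) lam_pos[OF I] by (intro mult_right_mono) auto
    finally have "D * lam I' * dist (word_map S J x) (word_map S J y) \<le> L * lam I * dist x y"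
      using le lam_pos[OF I] L(2) D1 by (intro mult_mono[of "D * lam I'" "L * lam I"]) auto
    with * show ?thesis by linarith
  qed
  have lower: "lam I * dist x y \<le> L * dist (word_map S I x) (word_map S I y)"
    if I: "I \<in> lists {1..N}" and xy: "x \<in> K" "y \<in> K" for I x y
  proof -
    have "ball x \<epsilon> \<subseteq> nbhd \<epsilon>" using xy by (force simp: nbhd_def)
    note w = word_map_conformal[OF I] and sub = this
    have V: "ball x \<epsilon> \<subseteq> V" using sub eps by simp
    show ?thesis
    proof (cases "dist x y < \<epsilon>")
      case True
      have "lam I / D * dist x y \<le> dist (word_map S I x) (word_map S I y)"
      proof (rule conformal_on_dist_ge[where \<rho> = \<epsilon>])
        show "conformal_on (ball x \<epsilon>) (word_map S I)" using w V by (meson conformal_on_subset)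
        show "inj_on (word_map S I) (ball x \<epsilon>)" using w V by (meson inj_on_subset)
        show "lam I / D \<le> deriv_norm (word_map S I) z" if "z \<in> ball x \<epsilon>" for z
          using distortion[OF I x0_nbhd, of z] that sub D1 by (auto simp: lam_def field_simps)
      qed (use D1 lam_pos[OF I] True in auto)
      then have "lam I * dist x y \<le> D * dist (word_map S I x) (word_map S I y)"
        using D1 by (simp add: field_simps)
      also have "\<dots> \<le> L * dist (word_map S I x) (word_map S I y)"
        using L(2) by (intro mult_right_mono) auto
      finally show ?thesis .
    next
      case False
      have "word_map S I y \<notin> word_map S I ` ball x \<epsilon>"
        using False w xy K_sub_V V by (auto dest: inj_onD)
      then have "word_map S I y \<notin> ball (word_map S I x) (\<epsilon> * (lam I / D))"
        using ball_subset_word_map_image[OF I sub eps(1)] by blast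
      then have "\<epsilon> * lam I \<le> D * dist (word_map S I x) (word_map S I y)"
        using D1 by (simp add: field_simps)
      then have "lam I \<le> D / \<epsilon> * dist (word_map S I x) (word_map S I y)"
        using eps(1) by (simp add: field_simps)
      then have "lam I * dist x y \<le> (D / \<epsilon> * dist (word_map S I x) (word_map S I y)) * \<Delta>"
        using \<Delta>(2)[OF xy] lam_pos[OF I] \<Delta>(1) D1 eps(1) by (intro mult_mono) auto
      also have "\<dots> = D * \<Delta> / \<epsilon> * dist (word_map S I x) (word_map S I y)" by simp
      also have "\<dots> \<le> L * dist (word_map S I x) (word_map S I y)"
        using L(3) by (intro mult_right_mono) auto
      finally show ?thesis .
    qed
  qed
  show thesis by (rule that[of L]) (use L D1 upper lower in auto)
qed

text \<open>
  Strip the common prefix, which is injective; the first differing letters then separate the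
  images.
\<close>

lemma incomparable_images_disjoint:
  assumes U: "U \<subseteq> V" "\<And>i. i \<in> {1..N} \<Longrightarrow> S i ` U \<subseteq> U"
      "\<And>i j. i \<in> {1..N} \<Longrightarrow> j \<in> {1..N} \<Longrightarrow> i \<noteq> j \<Longrightarrow> S i ` U \<inter> S j ` U = {}"
    and "I \<in> lists {1..N}" "J \<in> lists {1..N}" "\<not> prefix I J" "\<not> prefix J I"
  shows "word_map S I ` U \<inter> word_map S J ` U = {}"
  using assms(4-7)
proof (induction I arbitrary: J)
  case (Cons i I)
  obtain j J' where J: "J = j # J'" using Cons.prems(3) by (cases J) auto
  have in_U: "word_map S I' x \<in> U" if "I' \<in> lists {1..N}" "x \<in> U" for I' x
    using that by (induction I') (use U(2) in auto)
  show ?case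
  proof (cases "i = j")
    case True
    then have "word_map S I ` U \<inter> word_map S J' ` U = {}" using Cons J by auto
    moreover have "inj_on (S i) U" using generator_conformal(2)[of i] Cons.hyps U(1) by (auto intro: inj_on_subset)
    moreover have "word_map S I x \<in> U" "word_map S J' x \<in> U" if "x \<in> U" for x
      using in_U Cons J that by auto
    ultimately have "S i ` (word_map S I ` U) \<inter> S i ` (word_map S J' ` U) = {}"
      by (subst inj_on_image_Int[symmetric, of _ U]) auto
    then show ?thesis using J True by (simp add: image_comp)
  next
    case False
    have "word_map S (i # I) ` U \<subseteq> S i ` U" "word_map S J ` U \<subseteq> S j ` U"
      using in_U Cons J by auto
    then show ?thesis using U(3)[OF _ _ False] Cons J by auto
  qed
qed auto

text \<open>
  Move a point of the open set \<open>U\<close> close to \<open>K\<close> by a long word and take a ball around it inside \<open>U\<close>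
  and inside the neighbourhood of \<open>K\<close> with bounded distortion.  Its images under the maps of the
  words in \<open>W\<close> contain disjoint balls of radius \<open>\<rho> * t\<close>, all inside a ball of radius \<open>R * t\<close>, and
  volume bounds their number.
\<close>

lemma cylinder_overlap_bounded:
  assumes osc: "open_set_condition V N S" and \<kappa>: "0 < \<kappa>" and B: "0 \<le> B"
  obtains Q :: real where "\<And>t p W. \<lbrakk>0 < t; finite W; W \<subseteq> lists {1..N};
      \<And>I. I \<in> W \<Longrightarrow> \<kappa> * t \<le> lam I \<and> lam I \<le> t \<and> word_map S I ` K \<inter> cball p (B * t) \<noteq> {};
      \<And>I J. I \<in> W \<Longrightarrow> J \<in> W \<Longrightarrow> I \<noteq> J \<Longrightarrow> \<not> prefix I J\<rbrakk> \<Longrightarrow> real (card W) \<le> Q"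
proof -
  obtain U where U: "open U" "U \<noteq> {}" "U \<subseteq> V" "\<And>i. i \<in> {1..N} \<Longrightarrow> S i ` U \<subseteq> U"
      "\<And>i j. i \<in> {1..N} \<Longrightarrow> j \<in> {1..N} \<Longrightarrow> i \<noteq> j \<Longrightarrow> S i ` U \<inter> S j ` U = {}"
    using osc unfolding open_set_condition_def by metis
  obtain c where c: "0 < c" "c < 1" "\<And>j. j \<in> {1..N} \<Longrightarrow> c-lipschitz_on V (S j)"
    using contraction_ratio by metis
  obtain L where L: "1 \<le> L"
    "\<And>I x y. I \<in> lists {1..N} \<Longrightarrow> x \<in> K \<Longrightarrow> y \<in> K \<Longrightarrow>
      dist (word_map S I x) (word_map S I y) \<le> L * lam I * dist x y"
    using word_map_quasi_similarity by metis
  define \<Delta> where "\<Delta> = diameter K"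
  have \<Delta>: "0 \<le> \<Delta>" "\<And>x y. x \<in> K \<Longrightarrow> y \<in> K \<Longrightarrow> dist x y \<le> \<Delta>"
    using diameter_ge_0[OF compact_imp_bounded[OF compact_K]]
      diameter_bounded_bound[OF compact_imp_bounded[OF compact_K]] by (force simp: \<Delta>_def)+
  obtain u where u: "u \<in> U" using U by auto
  have "(\<lambda>n. c ^ n * dist x0 u) \<longlonglongrightarrow> 0"
    using c by (intro tendsto_mult_left_zero LIMSEQ_realpow_zero) auto
  then have "eventually (\<lambda>n. c ^ n * dist x0 u < \<epsilon> / 2) sequentially"
    by (rule order_tendstoD) (use eps in auto)
  then obtain n where n: "c ^ n * dist x0 u < \<epsilon> / 2" by (auto simp: eventually_sequentially)
  have "1 \<le> N" using K_eq K_nonempty by (cases N) auto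
  \<comment> \<open>Any word of length \<open>n\<close> serves to bring \<open>u\<close> close to \<open>K\<close>.\<close>
  define J where "J = replicate n (1::nat)"
  have J: "J \<in> lists {1..N}" using \<open>1 \<le> N\<close> by (auto simp: J_def in_lists_conv_set)
  define u' k where "u' = word_map S J u" and "k = word_map S J x0"
  have in_U: "word_map S I x \<in> U" if "I \<in> lists {1..N}" "x \<in> U" for I x
    using that by (induction I) (use U(4) in auto)
  have u': "u' \<in> U" unfolding u'_def using in_U J u by auto
  have k: "k \<in> K" using word_map_conformal[OF J] x0 by (auto simp: k_def)
  have "dist k u' \<le> c ^ length J * dist x0 u"
    unfolding k_def u'_def using word_contracts[OF c(1,3) J] x0 K_sub_V u U(3) by auto
  with n have ku: "dist k u' < \<epsilon> / 2" by (simp add: J_def)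
  obtain r' where r': "0 < r'" "ball u' r' \<subseteq> U" using U(1) u' openE by metis
  define r where "r = min r' (\<epsilon> / 2)"
  have r: "0 < r" "ball u' r \<subseteq> U" using r' eps by (auto simp: r_def)
  have "ball u' r \<subseteq> cball k \<epsilon>"
  proof
    fix y assume "y \<in> ball u' r"
    then show "y \<in> cball k \<epsilon>" using ku dist_triangle[of k y u'] by (auto simp: r_def)
  qed
  then have rn: "ball u' r \<subseteq> nbhd \<epsilon>" using k by (auto simp: nbhd_def)
  \<comment> \<open>The terms of \<open>R\<close> bound the way from \<open>p\<close> to the cylinder, across it, from it to the image of \<open>u'\<close>,
    and through the ball around that image.\<close>
  define \<rho> R where "\<rho> = r * \<kappa> / D" and "R = B + L * \<Delta> + D * \<epsilon> + \<rho>"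
  have \<rho>: "0 < \<rho>" using r \<kappa> D1 by (simp add: \<rho>_def)
  have R: "0 < R" using \<rho> B L(1) \<Delta>(1) D1 eps by (auto simp: R_def intro!: add_nonneg_pos add_nonneg_nonneg)
  show thesis
  proof (rule that[of "(R / \<rho>) ^ DIM('a)"])
    fix t p W
    assume t: "0 < (t::real)" and W: "finite W" "W \<subseteq> lists {1..N}"
      and WI: "\<And>I. I \<in> W \<Longrightarrow> \<kappa> * t \<le> lam I \<and> lam I \<le> t \<and> word_map S I ` K \<inter> cball p (B * t) \<noteq> {}"
      and inc: "\<And>I J. I \<in> W \<Longrightarrow> J \<in> W \<Longrightarrow> I \<noteq> J \<Longrightarrow> \<not> prefix I J"
    have sub: "ball (word_map S I u') (\<rho> * t) \<subseteq> word_map S I ` U" if "I \<in> W" for I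
    proof -
      have "\<rho> * t \<le> r * (lam I / D)" using WI[OF that] r D1 by (simp add: \<rho>_def field_simps)
      then have "ball (word_map S I u') (\<rho> * t) \<subseteq> ball (word_map S I u') (r * (lam I / D))" by auto
      also have "\<dots> \<subseteq> word_map S I ` ball u' r"
        using ball_subset_word_map_image[OF _ rn r(1)] that W(2) by auto
      also have "\<dots> \<subseteq> word_map S I ` U" using r(2) by auto
      finally show ?thesis .
    qed
    have "real (card W) \<le> ((R * t) / (\<rho> * t)) ^ DIM('a)"
    proof (rule card_disjoint_balls_le[where p = "\<lambda>I. word_map S I u'" and q = p])
      show "finite W" "0 < \<rho> * t" "0 < R * t" using W \<rho> R t by auto
      show "ball (word_map S I u') (\<rho> * t) \<inter> ball (word_map S J u') (\<rho> * t) = {}"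
        if IJ: "I \<in> W" "J \<in> W" "I \<noteq> J" for I J
        using incomparable_images_disjoint[OF U(3-5), of I J] sub[OF IJ(1)] sub[OF IJ(2)] W(2)
          inc[OF IJ] inc[of J I] IJ by blast
      show "ball (word_map S I u') (\<rho> * t) \<subseteq> ball p (R * t)" if I: "I \<in> W" for I
      proof
        fix y assume "y \<in> ball (word_map S I u') (\<rho> * t)"
        then have y: "dist (word_map S I u') y < \<rho> * t" by simp
        have Il: "I \<in> lists {1..N}" using I W(2) by blast
        have lam: "0 < lam I" "lam I \<le> t" using lam_pos[OF Il] WI[OF I] by auto
        obtain x where x: "x \<in> K" "dist p (word_map S I x) \<le> B * t" using WI[OF I] by auto
        have 1: "dist (word_map S I x) (word_map S I k) \<le> L * t * \<Delta>"
        proof -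
          have "dist (word_map S I x) (word_map S I k) \<le> L * lam I * dist x k" using L(2) Il x k by auto
          also have "\<dots> \<le> L * t * \<Delta>" using L(1) lam \<Delta>(2)[OF x(1) k] by (intro mult_mono) auto
          finally show ?thesis .
        qed
        have 2: "dist (word_map S I k) (word_map S I u') \<le> D * t * \<epsilon>"
        proof -
          have "dist (word_map S I k) (word_map S I u') \<le> D * lam I * dist k u'"
            using dist_word_map_le_local[OF Il k, of u'] ku eps by auto
          also have "\<dots> \<le> D * t * \<epsilon>" using D1 lam ku eps by (intro mult_mono) auto
          finally show ?thesis .
        qed
        have "dist p y \<le> dist p (word_map S I x) + dist (word_map S I x) (word_map S I k)
            + dist (word_map S I k) (word_map S I u') + dist (word_map S I u') y"
          using dist_triangle[of p y "word_map S I u'"] dist_triangle[of p "word_map S I u'" "word_map S I k"]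
            dist_triangle[of p "word_map S I k" "word_map S I x"] by linarith
        also have "\<dots> < B * t + L * t * \<Delta> + D * t * \<epsilon> + \<rho> * t" using x(2) 1 2 y by linarith
        also have "\<dots> = R * t" by (simp add: R_def algebra_simps)
        finally show "y \<in> ball p (R * t)" by simp
      qed
    qed
    then show "real (card W) \<le> (R / \<rho>) ^ DIM('a)" using t by simp
  qed
qed

end

section \<open>Component counts, box dimension and word cylinders\<close>

lemma equiv_delta_equiv: "equiv E (delta_equiv \<delta> E)"
proof (rule equivI)
  show "refl_on E (delta_equiv \<delta> E)" by (auto simp: refl_on_def delta_equiv_def)
  have "sym (delta_step \<delta> E)" by (auto simp: sym_def delta_step_def dist_commute)
  then show "sym (delta_equiv \<delta> E)"
    by (auto simp: delta_equiv_def intro!: symI dest: sym_rtrancl symD)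
  show "trans (delta_equiv \<delta> E)"
    by (auto simp: trans_def delta_equiv_def intro: rtrancl_trans)
qed (auto simp: delta_equiv_def)

lemma finite_delta_components:
  assumes "compact E" "0 < \<delta>"
  shows "finite (E // delta_equiv \<delta> E)"
proof -
  obtain F where F: "finite F" "F \<subseteq> E" "E \<subseteq> (\<Union>x\<in>F. ball x \<delta>)"
    using assms compact_imp_seq_compact seq_compact_imp_totally_bounded by metis
  have "E // delta_equiv \<delta> E \<subseteq> (\<lambda>x. delta_equiv \<delta> E `` {x}) ` F"
  proof
    fix X assume "X \<in> E // delta_equiv \<delta> E"
    then obtain y where y: "y \<in> E" "X = delta_equiv \<delta> E `` {y}" by (auto elim: quotientE)
    then obtain x where x: "x \<in> F" "dist x y < \<delta>" using F by auto
    then have "(x, y) \<in> delta_equiv \<delta> E"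
      using y F by (auto simp: delta_equiv_def delta_step_def intro!: r_into_rtrancl)
    then show "X \<in> (\<lambda>x. delta_equiv \<delta> E `` {x}) ` F"
      using y x equiv_class_eq[OF equiv_delta_equiv] by blast
  qed
  then show ?thesis using F(1) by (metis finite_imageI finite_subset)
qed

text \<open>
  Chains with steps at most \<open>\<delta>\<close> in \<open>E\<close> are mapped to chains with steps at most \<open>\<eta>\<close>, so \<open>f\<close> induces
  a surjection between the sets of components.  Finiteness of the components of \<open>E\<close> matters
  because an infinite set has cardinality \<open>0\<close>.
\<close>

lemma component_count_image_le:
  assumes E: "compact E" "0 < \<delta>"
    and f: "\<And>x y. x \<in> E \<Longrightarrow> y \<in> E \<Longrightarrow> dist x y \<le> \<delta> \<Longrightarrow> dist (f x) (f y) \<le> \<eta>"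
  shows "component_count (f ` E) \<eta> \<le> component_count E \<delta>"
proof -
  define r r' where "r = delta_equiv \<delta> E" and "r' = delta_equiv \<eta> (f ` E)"
  have step: "(f x, f y) \<in> (delta_step \<eta> (f ` E))\<^sup>*" if "(x, y) \<in> (delta_step \<delta> E)\<^sup>*" for x y
    using that
  proof (induction rule: rtrancl_induct)
    case (step y z)
    then have "(f y, f z) \<in> delta_step \<eta> (f ` E)" using f by (auto simp: delta_step_def)
    with step.IH show ?case by (rule rtrancl_into_rtrancl)
  qed simp
  then have rel: "(f x, f y) \<in> r'" if "(x, y) \<in> r" for x y
    using that by (auto simp: r_def r'_def delta_equiv_def)
  have "(f ` E) // r' \<subseteq> (\<lambda>X. r' `` (f ` X)) ` (E // r)"
  proof
    fix Y assume "Y \<in> (f ` E) // r'"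
    then obtain x where x: "x \<in> E" "Y = r' `` {f x}" by (auto elim!: quotientE)
    have "(x, x) \<in> r" using x by (auto simp: r_def delta_equiv_def)
    have "r' `` {f y} = r' `` {f x}" if "(x, y) \<in> r" for y
      using rel[OF that] equiv_class_eq[OF equiv_delta_equiv] unfolding r'_def by blast
    then have "r' `` (f ` (r `` {x})) = Y" using x \<open>(x, x) \<in> r\<close> by blast
    then show "Y \<in> (\<lambda>X. r' `` (f ` X)) ` (E // r)" using x by (blast intro: quotientI)
  qed
  moreover have "finite (E // r)" unfolding r_def using E by (rule finite_delta_components)
  ultimately show ?thesis
    unfolding component_count_def r_def[symmetric] r'_def[symmetric] by (rule surj_card_le[rotated])
qed

text \<open>
  Comparable numbers have comparable powers; the absolute value of the exponent covers both signs
  and lets one lemma serve both directions of a comparison.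
\<close>

lemma powr_le_powr_of_comparable:
  fixes x t A s :: real
  assumes "0 < x" "0 < t" "1 \<le> A" "x \<le> A * t" "t \<le> A * x"
  shows "x powr s \<le> A powr \<bar>s\<bar> * t powr s"
proof (cases "0 \<le> s")
  case True
  then have "x powr s \<le> (A * t) powr s" using assms by (intro powr_mono2) auto
  then show ?thesis using True assms by (simp add: powr_mult)
next
  case False
  then have "x powr s \<le> (t / A) powr s"
    using assms by (intro powr_mono2') (auto simp: field_simps)
  then show ?thesis using False assms by (simp add: powr_divide powr_minus field_simps)
qed

lemma box_dim_eqI:
  assumes G: "0 < (G::real)"
    and le: "\<And>\<delta>. 0 < \<delta> \<Longrightarrow> \<delta> < 1 \<Longrightarrow> real (covering_number \<delta> E) \<le> G * \<delta> powr (- s)"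
    and ge: "\<And>\<delta>. 0 < \<delta> \<Longrightarrow> \<delta> < 1 \<Longrightarrow> \<delta> powr (- s) \<le> G * real (covering_number \<delta> E)"
  shows "box_dim E = s"
proof -
  define f where "f = (\<lambda>\<delta>. ln (real (covering_number \<delta> E)) / ln (1 / \<delta>))"
  have bounds: "s - ln G / ln (1 / \<delta>) \<le> f \<delta> \<and> f \<delta> \<le> s + ln G / ln (1 / \<delta>)" if "0 < \<delta>" "\<delta> < 1" for \<delta>
  proof -
    define n where "n = real (covering_number \<delta> E)"
    have l: "0 < ln (1 / \<delta>)" using that by simp
    have p: "0 < \<delta> powr (- s)" using that by simp
    have n: "n \<le> G * \<delta> powr (- s)" "\<delta> powr (- s) \<le> G * n" using le ge that by (auto simp: n_def)
    then have n0: "0 < n" using p G by (smt (verit) zero_less_mult_pos)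
    have eq: "ln (\<delta> powr (- s)) = s * ln (1 / \<delta>)" using that by (simp add: ln_div)
    have "ln n \<le> ln (G * \<delta> powr (- s))" using n n0 G p by (subst ln_le_cancel_iff) auto
    then have 1: "ln n \<le> ln G + s * ln (1 / \<delta>)" using G p eq by (simp add: ln_mult)
    have "ln (\<delta> powr (- s)) \<le> ln (G * n)" using n n0 G p by (subst ln_le_cancel_iff) auto
    then have 2: "s * ln (1 / \<delta>) \<le> ln G + ln n" using G n0 eq by (simp add: ln_mult)
    have "ln n / ln (1 / \<delta>) \<le> (ln G + s * ln (1 / \<delta>)) / ln (1 / \<delta>)"
      "(s * ln (1 / \<delta>) - ln G) / ln (1 / \<delta>) \<le> ln n / ln (1 / \<delta>)"
      using 1 2 l by (auto intro!: divide_right_mono)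
    then show ?thesis
      using l unfolding f_def n_def[symmetric] by (simp add: add_divide_distrib diff_divide_distrib)
  qed
  have ev: "eventually (\<lambda>\<delta>. 0 < \<delta> \<and> \<delta> < (1::real)) (at_right 0)"
    by (auto simp: eventually_at_right[of 0 1] intro: exI[of _ 1])
  have "(f \<longlongrightarrow> s) (at_right 0)"
  proof (rule tendsto_sandwich)
    show "eventually (\<lambda>\<delta>. s - ln G / ln (1 / \<delta>) \<le> f \<delta>) (at_right 0)"
      "eventually (\<lambda>\<delta>. f \<delta> \<le> s + ln G / ln (1 / \<delta>)) (at_right 0)"
      using ev by (auto elim!: eventually_mono dest: bounds)
    show "((\<lambda>\<delta>. s - ln G / ln (1 / \<delta>)) \<longlongrightarrow> s) (at_right 0)" by real_asymp
    show "((\<lambda>\<delta>. s + ln G / ln (1 / \<delta>)) \<longlongrightarrow> s) (at_right 0)" by real_asymp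
  qed
  then show ?thesis unfolding box_dim_def f_def by (intro tendsto_Lim) auto
qed

lemma word_cylinder_alt: "word_cylinder N I = {\<omega> \<in> streams {1..N}. \<forall>i<length I. \<omega> !! i = I ! i}"
  by (auto simp: word_cylinder_def list_eq_iff_nth_eq)

lemma sets_word_cylinder: "word_cylinder N I \<in> sets (stream_space (count_space {1..N}))"
proof -
  let ?M = "stream_space (count_space {1..N::nat})"
  have sp: "space ?M = streams {1..N}" by (simp add: space_stream_space)
  have 1: "{\<omega> \<in> space ?M. \<omega> !! i = a} \<in> sets ?M" for i and a :: nat
  proof -
    have "(\<lambda>\<omega>. \<omega> !! i) -` ({a} \<inter> {1..N}) \<inter> space ?M \<in> sets ?M"
      by (rule measurable_sets[OF measurable_snth]) auto
    moreover have "(\<lambda>\<omega>. \<omega> !! i) -` ({a} \<inter> {1..N}) \<inter> space ?M = {\<omega> \<in> space ?M. \<omega> !! i = a}"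
      using snth_in[of _ "{1..N}" i] unfolding sp by blast
    ultimately show ?thesis by simp
  qed
  have "word_cylinder N I = {\<omega> \<in> space ?M. \<forall>i\<in>{..<length I}. \<omega> !! i = I ! i}"
    unfolding word_cylinder_alt sp by auto
  also have "\<dots> \<in> sets ?M" by (rule sets.sets_Collect_finite_All) (use 1 in auto)
  finally show ?thesis .
qed

lemma measurable_stake_count_space:
  "stake n \<in> measurable (stream_space (count_space {1..N::nat})) (count_space UNIV)"
proof (subst measurable_count_space_eq_countable)
  show "stake n \<in> space (stream_space (count_space {1..N::nat})) \<rightarrow> UNIV \<and>
    (\<forall>I\<in>UNIV. stake n -` {I} \<inter> space (stream_space (count_space {1..N::nat})) \<in> sets (stream_space (count_space {1..N})))"
  proof (intro conjI ballI)
    fix I :: "nat list"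
    have "stake n -` {I} \<inter> space (stream_space (count_space {1..N::nat})) =
        (if length I = n then word_cylinder N I else {})"
      by (auto simp: word_cylinder_def space_stream_space)
    then show "stake n -` {I} \<inter> space (stream_space (count_space {1..N::nat})) \<in> sets (stream_space (count_space {1..N}))"
      using sets_word_cylinder by simp
  qed auto
qed auto

section \<open>Cylinder combinatorics of a quasi-self-similar set\<close>

text \<open>
  What the counting arguments retain of the conformal system: every \<open>word_map S I\<close> is a similarity of ratio
  \<open>lam I\<close> up to the factor \<open>L\<close>, one more letter shrinks \<open>lam\<close> at most by the factor \<open>\<kappa>\<close>, and
  cylinders of comparable size overlap boundedly.  The bound \<open>\<kappa> * L \<le> 1\<close> makes the scale
  estimate for stopping words hold also for the empty word, at every scale up to \<open>L\<close>.
\<close>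

locale quasi_self_similar_set =
  fixes K :: "'a::euclidean_space set" and N :: nat and S :: "nat \<Rightarrow> 'a \<Rightarrow> 'a"
    and lam :: "nat list \<Rightarrow> real" and L c \<kappa> B Q :: real
  assumes compact: "compact K" and nonempty: "K \<noteq> {}" and invariant: "K = (\<Union>j\<in>{1..N}. S j ` K)"
    and L1: "1 \<le> L" and c: "0 < c" "c < 1" and \<kappa>0: "0 < \<kappa>" and \<kappa>L: "\<kappa> * L \<le> 1" and B1: "1 \<le> B"
    and lam_pos: "\<And>I. I \<in> lists {1..N} \<Longrightarrow> 0 < lam I"
    and lam_Nil: "lam [] = 1"
    and lam_snoc: "\<And>I j. I \<in> lists {1..N} \<Longrightarrow> j \<in> {1..N} \<Longrightarrow> \<kappa> * lam I \<le> lam (I @ [j])"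
    and lam_le: "\<And>I. I \<in> lists {1..N} \<Longrightarrow> lam I \<le> L * c ^ length I"
    and dist_le: "\<And>I x y. I \<in> lists {1..N} \<Longrightarrow> x \<in> K \<Longrightarrow> y \<in> K \<Longrightarrow>
      dist (word_map S I x) (word_map S I y) \<le> L * lam I * dist x y"
    and dist_ge: "\<And>I x y. I \<in> lists {1..N} \<Longrightarrow> x \<in> K \<Longrightarrow> y \<in> K \<Longrightarrow>
      lam I * dist x y \<le> L * dist (word_map S I x) (word_map S I y)"
    and dist_le_B: "\<And>I x y. I \<in> lists {1..N} \<Longrightarrow> x \<in> K \<Longrightarrow> y \<in> K \<Longrightarrow>
      dist (word_map S I x) (word_map S I y) \<le> B * lam I"
    and overlap: "\<And>t p W. \<lbrakk>0 < t; finite W; W \<subseteq> lists {1..N};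
      \<And>I. I \<in> W \<Longrightarrow> \<kappa> * t \<le> lam I \<and> lam I \<le> t \<and> word_map S I ` K \<inter> cball p (B * t) \<noteq> {};
      \<And>I J. I \<in> W \<Longrightarrow> J \<in> W \<Longrightarrow> I \<noteq> J \<Longrightarrow> \<not> prefix I J\<rbrakk> \<Longrightarrow> real (card W) \<le> Q"
begin

lemma word_map_sub:
  assumes "I \<in> lists {1..N}"
  shows "word_map S I ` K \<subseteq> K"
  using assms
proof (induction I)
  case (Cons i I)
  have "S i ` K \<subseteq> K" using invariant Cons.hyps(1) by blast
  with Cons.IH show ?case unfolding word_map_Cons image_comp[symmetric] by blast
qed simp

lemma word_map_prefix:
  assumes "prefix J I" "I \<in> lists {1..N}"
  shows "word_map S I ` K \<subseteq> word_map S J ` K"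
proof -
  obtain P where P: "I = J @ P" using assms(1) by (auto simp: prefix_def)
  then have "word_map S P ` K \<subseteq> K" using word_map_sub assms(2) by auto
  then show ?thesis unfolding P word_map_append image_comp[symmetric] by blast
qed

lemma in_cylinder_of_length:
  assumes "x \<in> K"
  obtains I where "I \<in> lists {1..N}" "length I = n" "x \<in> word_map S I ` K"
proof -
  have "\<exists>I\<in>lists {1..N}. length I = n \<and> x \<in> word_map S I ` K"
    using assms
  proof (induction n arbitrary: x)
    case 0
    then show ?case by (intro bexI[of _ "[]"]) auto
  next
    case (Suc n)
    obtain j y where j: "j \<in> {1..N}" "y \<in> K" "x = S j y" using Suc.prems invariant by blast
    obtain I where "I \<in> lists {1..N}" "length I = n" "y \<in> word_map S I ` K"
      using Suc.IH[OF j(2)] by blast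
    with j show ?case by (intro bexI[of _ "j # I"]) auto
  qed
  with that show thesis by blast
qed

lemma compact_cylinder:
  assumes I: "I \<in> lists {1..N}"
  shows "compact (word_map S I ` K)"
proof (rule compact_continuous_image[OF _ compact])
  have "(L * lam I)-lipschitz_on K (word_map S I)"
    using dist_le[OF I] L1 lam_pos[OF I] by (intro lipschitz_onI) auto
  then show "continuous_on K (word_map S I)" by (rule lipschitz_on_continuous_on)
qed

text \<open>
  The words at which \<open>lam\<close> first drops to \<open>t\<close>.  Since \<open>lam\<close> need not decrease along prefixes,
  all proper prefixes are required to exceed \<open>t\<close>, which makes the set prefix-free.
\<close>

definition stopping :: "real \<Rightarrow> nat list set" where
  "stopping t = {I \<in> lists {1..N}. lam I \<le> t \<and> (\<forall>J. strict_prefix J I \<longrightarrow> t < lam J)}"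

lemma stopping_lists: "I \<in> stopping t \<Longrightarrow> I \<in> lists {1..N}"
  by (simp add: stopping_def)

lemma stopping_antichain: "I \<in> stopping t \<Longrightarrow> J \<in> stopping t \<Longrightarrow> I \<noteq> J \<Longrightarrow> \<not> prefix I J"
  by (force simp: stopping_def strict_prefix_def)

lemma lam_eventually_small:
  assumes "0 < t"
  obtains n where "\<And>I. I \<in> lists {1..N} \<Longrightarrow> length I = n \<Longrightarrow> lam I \<le> t"
proof -
  have "(\<lambda>n. L * c ^ n) \<longlonglongrightarrow> 0"
    using c by (intro tendsto_mult_right_zero LIMSEQ_realpow_zero) auto
  then have "eventually (\<lambda>n. L * c ^ n < t) sequentially" using assms by (rule order_tendstoD)
  then obtain n where "L * c ^ n < t" by (auto simp: eventually_sequentially)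
  then show thesis using lam_le by (intro that[of n]) fastforce
qed

lemma finite_stopping:
  assumes t: "0 < t"
  shows "finite (stopping t)"
proof -
  obtain n where n: "\<And>I. I \<in> lists {1..N} \<Longrightarrow> length I = n \<Longrightarrow> lam I \<le> t"
    using lam_eventually_small[OF t] by metis
  have "length I \<le> n" if I: "I \<in> stopping t" for I
  proof (rule ccontr)
    assume "\<not> length I \<le> n"
    then have "strict_prefix (take n I) I" "length (take n I) = n"
      by (auto simp: strict_prefix_def take_is_prefix dest: arg_cong[where f = length])
    moreover have "take n I \<in> lists {1..N}" using stopping_lists[OF I] by (auto dest: in_set_takeD)
    ultimately show False using I n by (force simp: stopping_def)
  qed
  then have "stopping t \<subseteq> {I. set I \<subseteq> {1..N} \<and> length I \<le> n}"
    using stopping_lists by (auto simp: in_lists_conv_set)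
  then show ?thesis by (rule finite_subset) (intro finite_lists_length_le finite_atLeastAtMost)
qed

text \<open>
  Cut the word at the first length at which \<open>lam\<close> is at most \<open>t\<close>.
\<close>

lemma stopping_prefix_exists:
  assumes I: "I \<in> lists {1..N}" and le: "lam I \<le> t"
  obtains J where "J \<in> stopping t" "prefix J I"
proof -
  define n where "n = (LEAST n. lam (take n I) \<le> t)"
  have 1: "lam (take n I) \<le> t"
    unfolding n_def by (rule LeastI[of _ "length I"]) (simp add: le)
  have "t < lam P" if "strict_prefix P (take n I)" for P
  proof -
    have "length P < length (take n I)" using that by (rule prefix_length_less)
    then have "length P < n" by simp
    moreover from this have "P = take (length P) I"
      using that by (auto simp: strict_prefix_def prefix_def) (metis append_eq_conv_conj min_absorb1 less_imp_le take_take)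
    ultimately show ?thesis using not_less_Least[of "length P" "\<lambda>n. lam (take n I) \<le> t"] by (auto simp: n_def)
  qed
  moreover have "take n I \<in> lists {1..N}" using I by (auto dest: in_set_takeD)
  ultimately have "take n I \<in> stopping t" using 1 by (simp add: stopping_def)
  then show thesis using that take_is_prefix by blast
qed

text \<open>
  The word without its last letter still has \<open>lam\<close> above \<open>t\<close>, and one letter costs at most the
  factor \<open>\<kappa>\<close>.  The empty word, with \<open>lam [] = 1\<close>, is covered by \<open>\<kappa> * L \<le> 1\<close>.
\<close>

lemma stopping_lam_ge:
  assumes I: "I \<in> stopping t" and t: "t \<le> L"
  shows "\<kappa> * t \<le> lam I"
proof (cases I rule: rev_cases)
  case Nil
  have "\<kappa> * t \<le> \<kappa> * L" using t \<kappa>0 by (intro mult_left_mono) auto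
  then show ?thesis using Nil \<kappa>L lam_Nil by simp
next
  case (snoc J j)
  then have "t < lam J" using I by (auto simp: stopping_def strict_prefix_def)
  then have "\<kappa> * t \<le> \<kappa> * lam J" using \<kappa>0 by (intro mult_left_mono) auto
  also have "\<dots> \<le> lam I" using lam_snoc[of J j] stopping_lists[OF I] snoc by auto
  finally show ?thesis .
qed

lemma card_stopping_meeting_le:
  assumes t: "0 < t" "t \<le> L" and A: "A \<subseteq> cball p (B * t)"
  shows "real (card {I \<in> stopping t. word_map S I ` K \<inter> A \<noteq> {}}) \<le> Q"
proof (rule overlap[OF t(1)])
  show "finite {I \<in> stopping t. word_map S I ` K \<inter> A \<noteq> {}}" using finite_stopping[OF t(1)] by simp
  fix I assume I: "I \<in> {I \<in> stopping t. word_map S I ` K \<inter> A \<noteq> {}}"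
  then show "\<kappa> * t \<le> lam I \<and> lam I \<le> t \<and> word_map S I ` K \<inter> cball p (B * t) \<noteq> {}"
    using stopping_lam_ge[of I t] t(2) A by (auto simp: stopping_def)
qed (use stopping_lists stopping_antichain in blast)+

lemma Q_nonneg: "0 \<le> Q"
  using overlap[of 1 "{}"] by simp

lemma stopping_covers:
  assumes t: "0 < t"
  shows "K \<subseteq> (\<Union>I\<in>stopping t. word_map S I ` K)"
proof
  fix x assume x: "x \<in> K"
  obtain n where n: "\<And>I. I \<in> lists {1..N} \<Longrightarrow> length I = n \<Longrightarrow> lam I \<le> t"
    using lam_eventually_small[OF t] by metis
  obtain I where I: "I \<in> lists {1..N}" "length I = n" "x \<in> word_map S I ` K"
    using in_cylinder_of_length[OF x] by metis
  obtain J where J: "J \<in> stopping t" "prefix J I" by (rule stopping_prefix_exists[OF I(1) n[OF I(1,2)]])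
  show "x \<in> (\<Union>I\<in>stopping t. word_map S I ` K)"
    using J(1) subsetD[OF word_map_prefix[OF J(2) I(1)] I(3)] by (rule UN_I)
qed

definition small_cover :: "real \<Rightarrow> 'a set set \<Rightarrow> bool" where
  "small_cover \<delta> F \<longleftrightarrow> finite F \<and> (\<forall>A\<in>F. bounded A \<and> diameter A \<le> \<delta>) \<and> K \<subseteq> \<Union>F"

lemma covering_number_eq: "covering_number \<delta> K = (LEAST n. \<exists>F. small_cover \<delta> F \<and> card F = n)"
  unfolding covering_number_def small_cover_def by (rule arg_cong[of _ _ Least]) blast

lemma small_cover_stopping:
  assumes \<delta>: "0 < \<delta>"
  shows "small_cover \<delta> ((\<lambda>I. word_map S I ` K) ` stopping (\<delta> / B))"
  unfolding small_cover_def
proof (intro conjI ballI)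
  let ?F = "(\<lambda>I. word_map S I ` K) ` stopping (\<delta> / B)"
  have t: "0 < \<delta> / B" using \<delta> B1 by simp
  show "finite ?F" using finite_stopping[OF t] by simp
  show "K \<subseteq> \<Union>?F" using stopping_covers[OF t] by simp
  fix A assume "A \<in> ?F"
  then obtain I where I: "I \<in> stopping (\<delta> / B)" "A = word_map S I ` K" by auto
  note l = stopping_lists[OF I(1)]
  show "bounded A" using compact_cylinder[OF l] I by (auto intro: compact_imp_bounded)
  have "B * lam I \<le> \<delta>" using I(1) B1 by (auto simp: stopping_def field_simps)
  then have d: "dist x y \<le> \<delta>" if "x \<in> A" "y \<in> A" for x y
    using dist_le_B[OF l] that I(2) by fastforce
  show "diameter A \<le> \<delta>"
  proof (rule diameter_le)
    show "norm (x - y) \<le> \<delta>" if "x \<in> A" "y \<in> A" for x y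
      using d[OF that] by (simp add: dist_norm)
  qed (use \<delta> in simp)
qed

lemma covering_number_le:
  assumes "0 < \<delta>"
  shows "covering_number \<delta> K \<le> card (stopping (\<delta> / B))"
proof -
  have "covering_number \<delta> K \<le> card ((\<lambda>I. word_map S I ` K) ` stopping (\<delta> / B))"
    unfolding covering_number_eq
    by (rule Least_le, rule exI, rule conjI[OF small_cover_stopping[OF assms] refl])
  also have "\<dots> \<le> card (stopping (\<delta> / B))"
    using assms B1 by (intro card_image_le finite_stopping) simp
  finally show ?thesis .
qed

text \<open>
  Every stopping cylinder meets some set of an optimal cover, and each of these sets, being contained
  in a ball of radius \<open>\<delta>\<close>, meets at most \<open>Q\<close> of them.
\<close>

lemma card_stopping_le_covering_number:
  assumes \<delta>: "0 < \<delta>" "\<delta> \<le> L"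
  shows "real (card (stopping \<delta>)) \<le> Q * real (covering_number \<delta> K)"
proof -
  have "\<exists>n F. small_cover \<delta> F \<and> card F = n"
    by (rule exI, rule exI, rule conjI[OF small_cover_stopping[OF \<delta>(1)] refl])
  from LeastI_ex[OF this] obtain F where "small_cover \<delta> F" "card F = covering_number \<delta> K"
    unfolding covering_number_eq by (elim exE conjE)
  then have F: "finite F" "card F = covering_number \<delta> K"
    "\<forall>A\<in>F. bounded A \<and> diameter A \<le> \<delta>" "K \<subseteq> \<Union>F" by (simp_all add: small_cover_def)
  have "stopping \<delta> \<subseteq> (\<Union>A\<in>F. {I \<in> stopping \<delta>. word_map S I ` K \<inter> A \<noteq> {}})"
  proof
    fix I assume I: "I \<in> stopping \<delta>"
    obtain x where "x \<in> K" using nonempty by auto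
    then have "word_map S I x \<in> \<Union>F" using F(4) word_map_sub[OF stopping_lists[OF I]] by auto
    then show "I \<in> (\<Union>A\<in>F. {I \<in> stopping \<delta>. word_map S I ` K \<inter> A \<noteq> {}})"
      using I \<open>x \<in> K\<close> by auto
  qed
  then have "card (stopping \<delta>) \<le> card (\<Union>A\<in>F. {I \<in> stopping \<delta>. word_map S I ` K \<inter> A \<noteq> {}})"
    using F(1) finite_stopping[OF \<delta>(1)] by (intro card_mono) auto
  also have "\<dots> \<le> (\<Sum>A\<in>F. card {I \<in> stopping \<delta>. word_map S I ` K \<inter> A \<noteq> {}})"
    using F(1) by (rule card_UN_le)
  finally have "real (card (stopping \<delta>)) \<le> real (\<Sum>A\<in>F. card {I \<in> stopping \<delta>. word_map S I ` K \<inter> A \<noteq> {}})"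
    by (rule of_nat_mono)
  also have "\<dots> = (\<Sum>A\<in>F. real (card {I \<in> stopping \<delta>. word_map S I ` K \<inter> A \<noteq> {}}))"
    by (rule of_nat_sum)
  also have "\<dots> \<le> (\<Sum>A\<in>F. Q)"
  proof (rule sum_mono)
    fix A assume A: "A \<in> F"
    show "real (card {I \<in> stopping \<delta>. word_map S I ` K \<inter> A \<noteq> {}}) \<le> Q"
    proof (cases "A = {}")
      case True
      then show ?thesis using Q_nonneg by simp
    next
      case False
      then obtain p where "p \<in> A" by auto
      then have "dist p x \<le> \<delta>" if "x \<in> A" for x
        using order_trans[OF diameter_bounded_bound[of A p x]] bspec[OF F(3) A] \<open>p \<in> A\<close> that by blast
      also have "\<delta> \<le> B * \<delta>" using B1 \<delta>(1) by simp
      finally have "A \<subseteq> cball p (B * \<delta>)" by auto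
      then show ?thesis by (rule card_stopping_meeting_le[OF \<delta>])
    qed
  qed
  also have "\<dots> = Q * real (covering_number \<delta> K)" using F by simp
  finally show ?thesis .
qed

lemma component_count_cylinder_le:
  assumes I: "I \<in> lists {1..N}" and \<delta>: "0 < \<delta>"
  shows "component_count (word_map S I ` K) \<delta> \<le> component_count K (\<delta> / (L * lam I))"
proof (rule component_count_image_le[OF compact])
  have p: "0 < L * lam I" using L1 lam_pos[OF I] by simp
  then show "0 < \<delta> / (L * lam I)" using \<delta> by simp
  fix x y assume xy: "x \<in> K" "y \<in> K" and "dist x y \<le> \<delta> / (L * lam I)"
  then have "L * lam I * dist x y \<le> \<delta>" using p by (simp add: field_simps)
  with dist_le[OF I xy] show "dist (word_map S I x) (word_map S I y) \<le> \<delta>" by linarith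
qed

text \<open>
  The inverse of \<open>word_map S I\<close> on \<open>K\<close> expands distances by at most \<open>L / lam I\<close>.
\<close>

lemma component_count_cylinder_ge:
  assumes I: "I \<in> lists {1..N}" and \<delta>: "0 < \<delta>"
  shows "component_count K (L * \<delta> / lam I) \<le> component_count (word_map S I ` K) \<delta>"
proof -
  define g where "g = inv_into K (word_map S I)"
  have inj: "inj_on (word_map S I) K"
  proof (rule inj_onI)
    fix x y assume xy: "x \<in> K" "y \<in> K" "word_map S I x = word_map S I y"
    then have "lam I * dist x y \<le> 0" using dist_ge[OF I xy(1,2)] by simp
    then show "x = y" using lam_pos[OF I] by (simp add: mult_le_0_iff)
  qed
  have "g ` (word_map S I ` K) = K" using inj by (simp add: g_def inv_into_image_cancel)
  moreover have "component_count (g ` (word_map S I ` K)) (L * \<delta> / lam I) \<le> component_count (word_map S I ` K) \<delta>"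
  proof (rule component_count_image_le[OF compact_cylinder[OF I] \<delta>])
    fix u v assume uv: "u \<in> word_map S I ` K" "v \<in> word_map S I ` K" "dist u v \<le> \<delta>"
    then obtain x y where xy: "x \<in> K" "y \<in> K" "u = word_map S I x" "v = word_map S I y" by auto
    have "lam I * dist x y \<le> L * dist u v" using dist_ge[OF I xy(1,2)] xy by simp
    also have "\<dots> \<le> L * \<delta>" using uv(3) L1 by simp
    finally show "dist (g u) (g v) \<le> L * \<delta> / lam I"
      using xy inj lam_pos[OF I] by (simp add: g_def field_simps)
  qed
  ultimately show ?thesis by simp
qed

lemma stake_in_lists: "\<omega> \<in> streams A \<Longrightarrow> stake n \<omega> \<in> lists A"
  by (induction n arbitrary: \<omega>) (auto simp: streams_shd streams_stl)

lemma stopping_cylinder_exists: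
  assumes t: "0 < t" and \<omega>: "\<omega> \<in> streams {1..N}"
  obtains I where "I \<in> stopping t" "\<omega> \<in> word_cylinder N I"
proof -
  obtain n where n: "\<And>I. I \<in> lists {1..N} \<Longrightarrow> length I = n \<Longrightarrow> lam I \<le> t"
    using lam_eventually_small[OF t] by metis
  obtain J where J: "J \<in> stopping t" "prefix J (stake n \<omega>)"
    by (rule stopping_prefix_exists[OF stake_in_lists[OF \<omega>] n[OF stake_in_lists[OF \<omega>] length_stake]])
  then have "J = take (length J) (stake n \<omega>)" "length J \<le> n"
    by (auto simp: prefix_def dest: arg_cong[where f = length])
  then have "stake (length J) \<omega> = J" by (simp add: take_stake)
  then show thesis using that J \<omega> by (simp add: word_cylinder_def)
qed

lemma prefix_stake: "m \<le> n \<Longrightarrow> prefix (stake m \<omega>) (stake n \<omega>)"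
  using take_is_prefix[of m "stake n \<omega>"] by (simp add: take_stake min_absorb1)

text \<open>
  The nested compact sets along \<open>\<omega>\<close> have a common point, unique because their diameters, at most
  \<open>B * lam (stake n \<omega>)\<close>, tend to \<open>0\<close>; so the description in \<open>coding_map\<close> denotes.
\<close>

lemma coding_map_in_cylinder:
  assumes \<omega>: "\<omega> \<in> streams {1..N}"
  shows "coding_map S K \<omega> \<in> word_map S (stake n \<omega>) ` K"
proof -
  note l = stake_in_lists[OF \<omega>]
  define F where "F n = word_map S (stake n \<omega>) ` K" for n
  have "\<Inter>(range F) \<noteq> {}"
  proof (rule compact_nest)
    fix m n :: nat assume "m \<le> n"
    then have "prefix (stake m \<omega>) (stake n \<omega>)" using take_is_prefix[of m "stake n \<omega>"] by (simp add: take_stake min_absorb1)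
    then show "F n \<subseteq> F m" unfolding F_def using l by (rule word_map_prefix)
  qed (use compact_cylinder[OF l] nonempty in \<open>auto simp: F_def\<close>)
  then obtain x where x: "\<And>n. x \<in> F n" by auto
  have uniq: "y = x" if y: "\<And>n. y \<in> F n" for y
  proof (rule ccontr)
    assume "y \<noteq> x"
    then have "0 < dist y x / (2 * B)" using B1 by simp
    then obtain n where n: "\<And>I. I \<in> lists {1..N} \<Longrightarrow> length I = n \<Longrightarrow> lam I \<le> dist y x / (2 * B)"
      using lam_eventually_small by metis
    have "dist y x \<le> B * lam (stake n \<omega>)" using x[of n] y[of n] dist_le_B[OF l] unfolding F_def by blast
    also have "\<dots> \<le> B * (dist y x / (2 * B))" using n[OF l] B1 by (intro mult_left_mono) auto
    also have "\<dots> = dist y x / 2" using B1 by simp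
    finally show False using \<open>y \<noteq> x\<close> by (simp add: dist_le_zero_iff[symmetric] del: dist_le_zero_iff)
  qed
  have "coding_map S K \<omega> = x"
    unfolding coding_map_def using x uniq by (intro the_equality) (auto simp: F_def)
  then show ?thesis using x by (simp add: F_def)
qed

end

section \<open>Mass of cylinders and the power law\<close>

locale gibbs_quasi_self_similar_set = quasi_self_similar_set + prob_space m for m :: "nat stream measure" +
  fixes s C :: real
  assumes sets_m: "sets m = sets (stream_space (count_space {1..N}))"
    and C1: "1 \<le> C"
    and gibbs_ge: "\<And>I. I \<in> lists {1..N} \<Longrightarrow> lam I powr s \<le> C * measure m (word_cylinder N I)"
    and gibbs_le: "\<And>I. I \<in> lists {1..N} \<Longrightarrow> measure m (word_cylinder N I) \<le> C * lam I powr s"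
begin

lemma space_m: "space m = streams {1..N}"
  using sets_eq_imp_space_eq[OF sets_m] by (simp add: space_stream_space)

lemma cylinder_in_sets: "word_cylinder N I \<in> sets m"
  using sets_word_cylinder sets_m by simp

text \<open>
  Every infinite word has exactly one prefix in the stopping set.
\<close>

lemma stopping_partition:
  assumes t: "0 < t"
  shows "(\<Sum>I\<in>stopping t. measure m (word_cylinder N I)) = 1"
proof -
  have "disjoint_family_on (word_cylinder N) (stopping t)"
  proof (clarsimp simp: disjoint_family_on_def)
    fix I J assume IJ: "I \<in> stopping t" "J \<in> stopping t" "I \<noteq> J"
    have False if "\<omega> \<in> word_cylinder N I" "\<omega> \<in> word_cylinder N J" for \<omega>
    proof -
      have "I = stake (length I) \<omega>" "J = stake (length J) \<omega>" using that by (auto simp: word_cylinder_def)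
      then have "prefix I J \<or> prefix J I"
        using prefix_stake[of "length I" "length J" \<omega>] prefix_stake[of "length J" "length I" \<omega>]
        by (metis nat_le_linear)
      then show False using stopping_antichain IJ by metis
    qed
    then show "word_cylinder N I \<inter> word_cylinder N J = {}" by blast
  qed
  then have "(\<Sum>I\<in>stopping t. measure m (word_cylinder N I)) = measure m (\<Union>I\<in>stopping t. word_cylinder N I)"
    using cylinder_in_sets by (intro finite_measure_finite_Union[symmetric] finite_stopping t) auto
  also have "(\<Union>I\<in>stopping t. word_cylinder N I) = space m"
  proof
    show "(\<Union>I\<in>stopping t. word_cylinder N I) \<subseteq> space m" by (auto simp: space_m word_cylinder_def)
    show "space m \<subseteq> (\<Union>I\<in>stopping t. word_cylinder N I)"
    proof
      fix \<omega> assume "\<omega> \<in> space m"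
      then obtain I where "I \<in> stopping t" "\<omega> \<in> word_cylinder N I"
        using stopping_cylinder_exists[OF t] space_m by blast
      then show "\<omega> \<in> (\<Union>I\<in>stopping t. word_cylinder N I)" by blast
    qed
  qed
  finally show ?thesis by (simp add: prob_space)
qed


text \<open>
  The Gibbs constant, enlarged to absorb that \<open>lam\<close> agrees with \<open>t\<close> on stopping words only up to the
  factor \<open>\<kappa>\<close>.
\<close>

definition G :: real where "G = C * (1 / \<kappa>) powr \<bar>s\<bar>"

lemma G_ge_1: "1 \<le> G" and kappa_le_1: "\<kappa> \<le> 1"
proof -
  have "\<kappa> * 1 \<le> \<kappa> * L" using L1 \<kappa>0 by (intro mult_left_mono) auto
  then show "\<kappa> \<le> 1" using \<kappa>L by simp
  then have "1 \<le> (1 / \<kappa>) powr \<bar>s\<bar>" using \<kappa>0 by (intro ge_one_powr_ge_zero) auto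
  then show "1 \<le> G" using C1 mult_mono[of 1 C 1 "(1 / \<kappa>) powr \<bar>s\<bar>"] by (simp add: G_def)
qed

lemma stopping_cylinder_measure:
  assumes I: "I \<in> stopping t" and t: "0 < t" "t \<le> L"
  shows "t powr s \<le> G * measure m (word_cylinder N I)" "measure m (word_cylinder N I) \<le> G * t powr s"
proof -
  note l = stopping_lists[OF I]
  have *: "\<kappa> * t \<le> lam I" "lam I \<le> t" using stopping_lam_ge[OF I t(2)] I by (auto simp: stopping_def)
  have "\<kappa> * lam I \<le> 1 * lam I" using kappa_le_1 lam_pos[OF l] by (intro mult_right_mono) auto
  with * have "t \<le> 1 / \<kappa> * lam I" "lam I \<le> 1 / \<kappa> * t" using \<kappa>0 by (auto simp: field_simps)
  moreover have "1 \<le> 1 / \<kappa>" using \<kappa>0 kappa_le_1 by simp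
  ultimately have cmp: "t powr s \<le> (1 / \<kappa>) powr \<bar>s\<bar> * lam I powr s"
    "lam I powr s \<le> (1 / \<kappa>) powr \<bar>s\<bar> * t powr s"
    using lam_pos[OF l] t(1) by (auto intro: powr_le_powr_of_comparable)
  have "(1 / \<kappa>) powr \<bar>s\<bar> * lam I powr s \<le> (1 / \<kappa>) powr \<bar>s\<bar> * (C * measure m (word_cylinder N I))"
    using gibbs_ge[OF l] by (intro mult_left_mono) auto
  with cmp(1) show "t powr s \<le> G * measure m (word_cylinder N I)" by (simp add: G_def algebra_simps)
  have "C * lam I powr s \<le> C * ((1 / \<kappa>) powr \<bar>s\<bar> * t powr s)"
    using cmp(2) C1 by (intro mult_left_mono) auto
  with gibbs_le[OF l] show "measure m (word_cylinder N I) \<le> G * t powr s" by (simp add: G_def algebra_simps)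
qed

text \<open>
  The stopping cylinders have total mass \<open>1\<close>, and each has mass comparable to \<open>t powr s\<close>.
\<close>

lemma card_stopping_bounds:
  assumes t: "0 < t" "t \<le> L"
  shows "real (card (stopping t)) \<le> G * t powr (- s)" "t powr (- s) \<le> G * real (card (stopping t))"
proof -
  have p: "0 < t powr s" using t by simp
  have "real (card (stopping t)) * t powr s = (\<Sum>I\<in>stopping t. t powr s)" by simp
  also have "\<dots> \<le> (\<Sum>I\<in>stopping t. G * measure m (word_cylinder N I))"
    by (intro sum_mono stopping_cylinder_measure t)
  also have "\<dots> = G" using stopping_partition[OF t(1)] by (simp add: sum_distrib_left[symmetric])
  finally show "real (card (stopping t)) \<le> G * t powr (- s)" using p by (simp add: powr_minus field_simps)
  have "1 = (\<Sum>I\<in>stopping t. measure m (word_cylinder N I))" using stopping_partition[OF t(1)] by simp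
  also have "\<dots> \<le> (\<Sum>I\<in>stopping t. G * t powr s)"
    by (intro sum_mono stopping_cylinder_measure t)
  finally show "t powr (- s) \<le> G * real (card (stopping t))" using p by (simp add: powr_minus field_simps)
qed

text \<open>
  Stopping cylinders at scale \<open>\<delta> / B\<close> form a cover of \<open>K\<close> by sets of diameter at most \<open>\<delta>\<close>; by
  bounded overlap, no cover is essentially more economical.  So the covering number is
  comparable to \<open>\<delta> powr (- s)\<close>.
\<close>

lemma box_dim_eq: "box_dim K = s"
proof (rule box_dim_eqI)
  define H where "H = G * B powr \<bar>s\<bar> + G * Q"
  have GB: "0 < G * B powr \<bar>s\<bar>" using G_ge_1 B1 by simp
  have GQ: "0 \<le> G * Q" using G_ge_1 Q_nonneg by simp
  show "0 < H" using GB GQ by (simp add: H_def)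
  fix \<delta> :: real assume \<delta>: "0 < \<delta>" "\<delta> < 1"
  have le1: "\<delta> \<le> L" using \<delta> L1 by simp
  have "\<delta> / B \<le> \<delta>" using B1 \<delta> by (simp add: field_simps)
  then have t: "0 < \<delta> / B" "\<delta> / B \<le> L" using B1 \<delta> le1 by auto
  have "real (covering_number \<delta> K) \<le> real (card (stopping (\<delta> / B)))"
    using covering_number_le[OF \<delta>(1)] by simp
  also have "\<dots> \<le> G * (\<delta> / B) powr (- s)" by (rule card_stopping_bounds[OF t])
  also have "\<dots> = G * B powr s * \<delta> powr (- s)"
    using B1 \<delta> by (simp add: powr_divide powr_minus field_simps)
  also have "\<dots> \<le> G * B powr \<bar>s\<bar> * \<delta> powr (- s)"
    using B1 G_ge_1 by (intro mult_right_mono mult_left_mono powr_mono) auto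
  also have "\<dots> \<le> H * \<delta> powr (- s)"
    using GQ by (intro mult_right_mono) (auto simp: H_def)
  finally show "real (covering_number \<delta> K) \<le> H * \<delta> powr (- s)" .
  have "\<delta> powr (- s) \<le> G * real (card (stopping \<delta>))" by (rule card_stopping_bounds[OF \<delta>(1) le1])
  also have "\<dots> \<le> G * (Q * real (covering_number \<delta> K))"
    using card_stopping_le_covering_number[OF \<delta>(1) le1] G_ge_1 by (intro mult_left_mono) auto
  also have "\<dots> = G * Q * real (covering_number \<delta> K)" by simp
  also have "\<dots> \<le> H * real (covering_number \<delta> K)"
    using GB by (intro mult_right_mono) (auto simp: H_def)
  finally show "\<delta> powr (- s) \<le> H * real (covering_number \<delta> K)" .
qed

text \<open>
  The coding map is the pointwise limit of the maps \<open>\<omega> \<mapsto> word_map S (stake n \<omega>) x\<close>, which depend on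
  finitely many letters only.
\<close>

lemma coding_map_measurable: "coding_map S K \<in> measurable m (restrict_space borel K)"
proof (rule measurable_restrict_space2)
  obtain x where x: "x \<in> K" using nonempty by auto
  have l: "stake n \<omega> \<in> lists {1..N}" if "\<omega> \<in> space m" for \<omega> n
    using that stake_in_lists space_m by auto
  have cod: "coding_map S K \<omega> \<in> word_map S (stake n \<omega>) ` K" if "\<omega> \<in> space m" for \<omega> n
    using that coding_map_in_cylinder space_m by auto
  show "coding_map S K \<in> space m \<rightarrow> K"
    using cod[of _ 0] by auto
  show "coding_map S K \<in> borel_measurable m"
  proof (rule borel_measurable_LIMSEQ_metric)
    fix n
    have "stake n \<in> measurable m (count_space UNIV)"
      using measurable_stake_count_space[of n N] measurable_cong_sets[OF sets_m refl] by blast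
    then show "(\<lambda>\<omega>. word_map S (stake n \<omega>) x) \<in> borel_measurable m"
      by (rule measurable_compose) simp
  next
    fix \<omega> assume \<omega>: "\<omega> \<in> space m"
    have bound: "dist (word_map S (stake n \<omega>) x) (coding_map S K \<omega>) \<le> B * L * c ^ n" for n
    proof -
      obtain y where y: "y \<in> K" "coding_map S K \<omega> = word_map S (stake n \<omega>) y" using cod[OF \<omega>] by auto
      then have "dist (word_map S (stake n \<omega>) x) (coding_map S K \<omega>) \<le> B * lam (stake n \<omega>)"
        using dist_le_B[OF l[OF \<omega>] x y(1)] by simp
      also have "\<dots> \<le> B * (L * c ^ n)"
        using lam_le[OF l[OF \<omega>], of n] B1 by (intro mult_left_mono) auto
      finally show ?thesis by (simp add: mult.assoc)
    qed
    have null: "(\<lambda>n. B * L * c ^ n) \<longlonglongrightarrow> 0"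
      using c by (intro tendsto_mult_right_zero LIMSEQ_realpow_zero) auto
    have "(\<lambda>n. dist (word_map S (stake n \<omega>) x) (coding_map S K \<omega>)) \<longlonglongrightarrow> 0"
      by (rule Lim_null_comparison[OF always_eventually null]) (simp add: bound)
    then show "(\<lambda>n. word_map S (stake n \<omega>) x) \<longlonglongrightarrow> coding_map S K \<omega>"
      by (rule tendsto_dist_iff[THEN iffD2])
  qed
qed

definition \<mu> :: "'a measure" where "\<mu> = distr m (restrict_space borel K) (coding_map S K)"

lemma measure_image_cylinder:
  assumes I: "I \<in> lists {1..N}"
  shows "measure \<mu> (word_map S I ` K) = measure m (coding_map S K -` (word_map S I ` K) \<inter> space m)"
    "coding_map S K -` (word_map S I ` K) \<inter> space m \<in> sets m"
proof -
  have "word_map S I ` K \<in> sets borel" using compact_cylinder[OF I] by (intro borel_closed compact_imp_closed)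
  then have sets: "word_map S I ` K \<in> sets (restrict_space borel K)"
    using word_map_sub[OF I] by (auto simp: sets_restrict_space image_iff intro!: bexI[of _ "word_map S I ` K"])
  show "measure \<mu> (word_map S I ` K) = measure m (coding_map S K -` (word_map S I ` K) \<inter> space m)"
    unfolding \<mu>_def by (rule measure_distr[OF coding_map_measurable sets])
  show "coding_map S K -` (word_map S I ` K) \<inter> space m \<in> sets m"
    by (rule measurable_sets[OF coding_map_measurable sets])
qed

lemma measure_cylinder_ge:
  assumes I: "I \<in> lists {1..N}"
  shows "lam I powr s \<le> C * measure \<mu> (word_map S I ` K)"
proof -
  have "word_cylinder N I \<subseteq> coding_map S K -` (word_map S I ` K) \<inter> space m"
  proof
    fix \<omega> assume "\<omega> \<in> word_cylinder N I"
    then have "\<omega> \<in> streams {1..N}" "stake (length I) \<omega> = I" by (simp_all add: word_cylinder_def)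
    then show "\<omega> \<in> coding_map S K -` (word_map S I ` K) \<inter> space m"
      using coding_map_in_cylinder[of \<omega> "length I"] by (simp add: space_m)
  qed
  then have "measure m (word_cylinder N I) \<le> measure \<mu> (word_map S I ` K)"
    unfolding measure_image_cylinder(1)[OF I] by (intro finite_measure_mono measure_image_cylinder I)
  then have "C * measure m (word_cylinder N I) \<le> C * measure \<mu> (word_map S I ` K)"
    using C1 by (intro mult_left_mono) auto
  with gibbs_ge[OF I] show ?thesis by linarith
qed

text \<open>
  A code of a point of the cylinder of \<open>I\<close> need not start with \<open>I\<close>, but it starts with a stopping word at
  scale \<open>lam I\<close> whose cylinder meets that of \<open>I\<close>.  At most \<open>Q\<close> words qualify, each carrying mass
  comparable to \<open>lam I powr s\<close>.
\<close>

lemma measure_cylinder_le: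
  assumes I: "I \<in> lists {1..N}"
  shows "measure \<mu> (word_map S I ` K) \<le> Q * G * lam I powr s"
proof -
  define t where "t = lam I"
  define T where "T = {J \<in> stopping t. word_map S J ` K \<inter> word_map S I ` K \<noteq> {}}"
  have "lam I \<le> L * 1" using lam_le[OF I] L1 c
    by (elim order_trans) (intro mult_left_mono power_le_one, auto)
  then have t: "0 < t" "t \<le> L" using lam_pos[OF I] by (auto simp: t_def)
  have fin: "finite T" using finite_stopping[OF t(1)] by (simp add: T_def)
  obtain x where x: "x \<in> K" using nonempty by auto
  have "word_map S I ` K \<subseteq> cball (word_map S I x) (B * t)"
    using dist_le_B[OF I x] by (auto simp: t_def)
  then have card: "real (card T) \<le> Q" unfolding T_def by (rule card_stopping_meeting_le[OF t])
  have "coding_map S K -` (word_map S I ` K) \<inter> space m \<subseteq> (\<Union>J\<in>T. word_cylinder N J)"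
  proof
    fix \<omega> assume \<omega>: "\<omega> \<in> coding_map S K -` (word_map S I ` K) \<inter> space m"
    then have \<omega>': "\<omega> \<in> streams {1..N}" by (simp add: space_m)
    obtain J where J: "J \<in> stopping t" "\<omega> \<in> word_cylinder N J"
      by (rule stopping_cylinder_exists[OF t(1) \<omega>'])
    have "coding_map S K \<omega> \<in> word_map S J ` K"
      using coding_map_in_cylinder[OF \<omega>', of "length J"] J(2) by (simp add: word_cylinder_def)
    then show "\<omega> \<in> (\<Union>J\<in>T. word_cylinder N J)" using J \<omega> by (auto simp: T_def)
  qed
  then have "measure \<mu> (word_map S I ` K) \<le> measure m (\<Union>J\<in>T. word_cylinder N J)"
    unfolding measure_image_cylinder(1)[OF I] using fin cylinder_in_sets
    by (intro finite_measure_mono) auto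
  also have "\<dots> \<le> (\<Sum>J\<in>T. measure m (word_cylinder N J))"
    using fin cylinder_in_sets by (intro finite_measure_subadditive_finite) auto
  also have "\<dots> \<le> (\<Sum>J\<in>T. G * t powr s)"
    by (intro sum_mono stopping_cylinder_measure t) (simp add: T_def)
  also have "\<dots> = real (card T) * (G * t powr s)" by simp
  also have "\<dots> \<le> Q * (G * t powr s)" using card G_ge_1 by (intro mult_right_mono) auto
  finally show ?thesis by (simp add: t_def)
qed

text \<open>
  Transfer the power law of \<open>K\<close> at the scales \<open>\<delta> / (L * l)\<close> and \<open>L * \<delta> / l\<close>, where \<open>l = lam I\<close>, to
  the cylinder of \<open>I\<close>, and replace \<open>l powr s\<close> by the mass of that cylinder.
\<close>

lemma component_counting_if_maximal_power_law:
  assumes "maximal_power_law K"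
  shows "component_counting_measure N S K \<mu>"
proof -
  obtain c0 where c0: "1 \<le> (c0::real)" and ev: "\<forall>\<^sub>F \<delta> in at_right 0.
      (1 / c0) * \<delta> powr (- s) \<le> real (component_count K \<delta>) \<and>
      real (component_count K \<delta>) \<le> c0 * \<delta> powr (- s)"
    using assms unfolding maximal_power_law_def box_dim_eq by (elim conjE exE)
  obtain \<delta>1 where \<delta>1: "0 < \<delta>1" "\<forall>\<delta>>0. \<delta> < \<delta>1 \<longrightarrow>
      (1 / c0) * \<delta> powr (- s) \<le> real (component_count K \<delta>) \<and>
      real (component_count K \<delta>) \<le> c0 * \<delta> powr (- s)"
    using ev unfolding eventually_at_right_field by (elim exE conjE)
  then have lo: "(1 / c0) * \<delta> powr (- s) \<le> real (component_count K \<delta>)"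
    and up: "real (component_count K \<delta>) \<le> c0 * \<delta> powr (- s)" if "0 < \<delta>" "\<delta> < \<delta>1" for \<delta>
    using that by simp_all
  define E where "E = L powr \<bar>s\<bar>"
  have E: "1 \<le> E" using L1 by (simp add: E_def ge_one_powr_ge_zero)
  define M where "M = c0 * E * (C + Q * G)"
  have QG: "0 \<le> Q * G" using Q_nonneg G_ge_1 by simp
  have "1 * 1 * 1 \<le> c0 * E * (C + Q * G)" using c0 E C1 QG by (intro mult_mono) auto
  then have M1: "1 \<le> M" by (simp add: M_def)
  have cE: "0 < c0 * E" using c0 E by simp
  have "\<exists>\<delta>0>0. \<forall>\<delta>. 0 < \<delta> \<and> \<delta> < \<delta>0 \<longrightarrow>
        (1 / M) * measure \<mu> R * \<delta> powr (- s) \<le> real (component_count R \<delta>) \<and>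
        real (component_count R \<delta>) \<le> M * measure \<mu> R * \<delta> powr (- s)" if cyl: "R \<in> cylinders N S K" for R
  proof -
    obtain I where I: "I \<in> lists {1..N}" and R: "R = word_map S I ` K"
      using cyl by (auto simp: cylinders_def)
    define l where "l = lam I"
    have l: "0 < l" using lam_pos[OF I] by (simp add: l_def)
    show ?thesis
    proof (intro exI[of _ "\<delta>1 * l / L"] conjI allI impI; (elim conjE)?)
      show "0 < \<delta>1 * l / L" using \<delta>1 l L1 by simp
      fix \<delta> assume \<delta>: "0 < \<delta>" "\<delta> < \<delta>1 * l / L"
      have d: "L * \<delta> / l < \<delta>1" using \<delta> l L1 by (simp add: field_simps)
      have "\<delta> / (L * l) \<le> L * \<delta> / l"
        using \<delta> l L1 mult_mono[of 1 L 1 L] by (simp add: field_simps)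
      with d have d': "\<delta> / (L * l) < \<delta>1" by simp
      have p: "0 < \<delta> powr (- s)" using \<delta> by simp
      have "real (component_count R \<delta>) \<le> real (component_count K (\<delta> / (L * l)))"
        unfolding R l_def using component_count_cylinder_le[OF I \<delta>(1)] by simp
      also have "\<dots> \<le> c0 * (\<delta> / (L * l)) powr (- s)" using d' \<delta> l L1 by (intro up) auto
      also have "\<dots> = c0 * L powr s * (l powr s * \<delta> powr (- s))"
        using \<delta> l L1 by (simp add: powr_divide powr_mult powr_minus field_simps)
      also have "\<dots> \<le> c0 * E * (l powr s * \<delta> powr (- s))"
        unfolding E_def using c0 L1 by (intro mult_right_mono mult_left_mono powr_mono) auto
      also have "\<dots> \<le> c0 * E * ((C + Q * G) * measure \<mu> R * \<delta> powr (- s))"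
      proof (intro mult_left_mono mult_right_mono)
        have "l powr s \<le> C * measure \<mu> R" using measure_cylinder_ge[OF I] by (simp add: R l_def)
        also have "\<dots> \<le> (C + Q * G) * measure \<mu> R" using QG by (intro mult_right_mono) auto
        finally show "l powr s \<le> (C + Q * G) * measure \<mu> R" .
      qed (use cE in auto)
      finally show "real (component_count R \<delta>) \<le> M * measure \<mu> R * \<delta> powr (- s)"
        by (simp add: M_def mult.assoc)
      have "measure \<mu> R * \<delta> powr (- s) \<le> (C + Q * G) * l powr s * \<delta> powr (- s)"
      proof (rule mult_right_mono)
        have "measure \<mu> R \<le> Q * G * l powr s" using measure_cylinder_le[OF I] by (simp add: R l_def)
        also have "\<dots> \<le> (C + Q * G) * l powr s" using C1 by (intro mult_right_mono) auto
        finally show "measure \<mu> R \<le> (C + Q * G) * l powr s" .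
      qed (use p in auto)
      also have "\<dots> = (C + Q * G) * (L powr s * (L * \<delta> / l) powr (- s))"
        using \<delta> l L1 by (simp add: powr_divide powr_mult powr_minus field_simps)
      also have "\<dots> \<le> (C + Q * G) * (E * (L * \<delta> / l) powr (- s))"
        unfolding E_def using C1 QG L1 by (intro mult_right_mono mult_left_mono powr_mono) auto
      also have "\<dots> = M * ((1 / c0) * (L * \<delta> / l) powr (- s))"
        using c0 by (simp add: M_def field_simps)
      also have "\<dots> \<le> M * real (component_count K (L * \<delta> / l))"
        using M1 d \<delta> l L1 by (intro mult_left_mono lo) auto
      also have "\<dots> \<le> M * real (component_count R \<delta>)"
        unfolding R l_def using component_count_cylinder_ge[OF I \<delta>(1)] M1 by (intro mult_left_mono) auto
      finally show "(1 / M) * measure \<mu> R * \<delta> powr (- s) \<le> real (component_count R \<delta>)"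
        using M1 by (simp add: field_simps)
    qed
  qed
  moreover have "finite_measure \<mu>"
    unfolding \<mu>_def using coding_map_measurable by (rule finite_measure_distr)
  moreover have "sets \<mu> = sets (restrict_space borel K)" by (simp add: \<mu>_def)
  ultimately show ?thesis
    unfolding component_counting_measure_def box_dim_eq using M1 by blast
qed

text \<open>
  The set \<open>K\<close> is the cylinder of the empty word and has mass \<open>1\<close>.
\<close>

lemma maximal_power_law_if_component_counting:
  assumes "component_counting_measure N S K \<mu>"
  shows "maximal_power_law K"
proof -
  interpret \<mu>: prob_space \<mu>
    unfolding \<mu>_def by (rule prob_space_distr[OF coding_map_measurable])
  have "space \<mu> = K" by (simp add: \<mu>_def space_restrict_space)
  then have K1: "measure \<mu> K = 1" using \<mu>.prob_space by simp
  have "K \<in> cylinders N S K" by (auto simp: cylinders_def intro!: image_eqI[of _ _ "[]"])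
  then obtain M \<delta>0 where "1 \<le> M" "0 < \<delta>0" "\<forall>\<delta>. 0 < \<delta> \<and> \<delta> < \<delta>0 \<longrightarrow>
        (1 / M) * \<delta> powr (- box_dim K) \<le> real (component_count K \<delta>) \<and>
        real (component_count K \<delta>) \<le> M * \<delta> powr (- box_dim K)"
    using assms K1 unfolding component_counting_measure_def by force
  then show ?thesis
    unfolding maximal_power_law_def eventually_at_right_field using compact by blast
qed

end

theorem theorem1p1:
  fixes \<alpha> :: real and V K :: "(real ^ 'd) set" and N :: nat
    and S :: "nat \<Rightarrow> real ^ 'd \<Rightarrow> real ^ 'd" and \<mu> :: "(real ^ 'd) measure"
  assumes "self_conformal_ifs \<alpha> V N S"
    and "is_attractor V N S K"
    and "open_set_condition V N S"
    and "is_gibbs_measure N S K \<mu>"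
  shows "maximal_power_law K \<longleftrightarrow> component_counting_measure N S K \<mu>"
proof -
  interpret conformal_ifs \<alpha> V K N S using assms(1,2) by unfold_locales
  obtain x0 where x0: "x0 \<in> K" using K_nonempty by auto
  obtain \<epsilon> where \<epsilon>: "0 < \<epsilon>" "nbhd \<epsilon> \<subseteq> V"
    using compact_subset_open_imp_cball_epsilon_subset[OF compact_K open_V K_sub_V]
    unfolding nbhd_def by metis
  obtain D where D: "1 \<le> D" "\<And>I x y. I \<in> lists {1..N} \<Longrightarrow> x \<in> nbhd \<epsilon> \<Longrightarrow> y \<in> nbhd \<epsilon> \<Longrightarrow>
    deriv_norm (word_map S I) x \<le> D * deriv_norm (word_map S I) y"
    using bounded_distortion[OF \<epsilon>] by metis
  interpret conformal_ifs_with_distortion \<alpha> V K N S \<epsilon> D x0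
    using \<epsilon> D x0 by unfold_locales auto
  obtain c where c: "0 < c" "c < 1" "\<And>j. j \<in> {1..N} \<Longrightarrow> c-lipschitz_on V (S j)"
    using contraction_ratio by metis
  obtain \<kappa>' where \<kappa>': "0 < \<kappa>'" "\<kappa>' \<le> 1"
    "\<And>I J. I \<in> lists {1..N} \<Longrightarrow> J \<in> lists {1..N} \<Longrightarrow> \<kappa>' ^ length J * lam I \<le> lam (I @ J)"
    using lam_append_ge by metis
  obtain L' where L': "1 \<le> L'"
    "\<And>I x y. I \<in> lists {1..N} \<Longrightarrow> x \<in> K \<Longrightarrow> y \<in> K \<Longrightarrow>
      dist (word_map S I x) (word_map S I y) \<le> L' * lam I * dist x y"
    "\<And>I x y. I \<in> lists {1..N} \<Longrightarrow> x \<in> K \<Longrightarrow> y \<in> K \<Longrightarrow>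
      lam I * dist x y \<le> L' * dist (word_map S I x) (word_map S I y)"
    using word_map_quasi_similarity by metis
  \<comment> \<open>\<open>L\<close> serves both as quasi-similarity constant and in \<open>lam I \<le> L * c ^ length I\<close>; the second entry of
    \<open>\<kappa>\<close> gives \<open>\<kappa> * L \<le> 1\<close>, and \<open>B * lam I\<close> bounds the diameter of the cylinder of \<open>I\<close>.\<close>
  define L where "L = max L' D"
  define \<kappa> where "\<kappa> = min \<kappa>' (1 / L)"
  define B where "B = 1 + L * diameter K"
  have bK: "bounded K" using compact_K by (rule compact_imp_bounded)
  have L: "1 \<le> L" "L' \<le> L" "D \<le> L" using L' by (auto simp: L_def)
  have \<kappa>: "0 < \<kappa>" "\<kappa> \<le> \<kappa>'" "\<kappa> \<le> 1 / L" using \<kappa>' L by (auto simp: \<kappa>_def)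
  have B: "1 \<le> B" using L diameter_ge_0[OF bK] by (simp add: B_def)
  have B0: "0 \<le> B" using B by simp
  obtain Q where Q: "\<And>t p W. \<lbrakk>0 < t; finite W; W \<subseteq> lists {1..N};
      \<And>I. I \<in> W \<Longrightarrow> \<kappa> * t \<le> lam I \<and> lam I \<le> t \<and> word_map S I ` K \<inter> cball p (B * t) \<noteq> {};
      \<And>I J. I \<in> W \<Longrightarrow> J \<in> W \<Longrightarrow> I \<noteq> J \<Longrightarrow> \<not> prefix I J\<rbrakk> \<Longrightarrow> real (card W) \<le> Q"
  proof (rule cylinder_overlap_bounded[OF assms(3) \<kappa>(1) B0], goal_cases)
    case (1 Q)
    show ?case by (rule 1(1), rule 1(2))
  qed
  have quasi: "quasi_self_similar_set K N S lam L c \<kappa> B Q"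
  proof
    show "compact K" "K \<noteq> {}" "K = (\<Union>j\<in>{1..N}. S j ` K)"
      using compact_K K_nonempty K_eq by auto
    show "\<kappa> * L \<le> 1" using \<kappa> L by (simp add: field_simps)
    show "lam [] = 1" by (rule lam_Nil)
    fix I :: "nat list" assume I: "I \<in> lists {1..N}"
    note pos = lam_pos[OF I]
    show "0 < lam I" by (rule pos)
    show "\<kappa> * lam I \<le> lam (I @ [j])" if "j \<in> {1..N}" for j
    proof -
      have "\<kappa> * lam I \<le> \<kappa>' * lam I" using \<kappa>(2) pos by (intro mult_right_mono) auto
      also have "\<dots> \<le> lam (I @ [j])" using \<kappa>'(3)[OF I, of "[j]"] that by auto
      finally show ?thesis .
    qed
    show "lam I \<le> L * c ^ length I"
    proof -
      have "lam I \<le> D * c ^ length I" using c(1,3) I by (rule lam_le_power)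
      also have "\<dots> \<le> L * c ^ length I" using L c(1) by (intro mult_right_mono) auto
      finally show ?thesis .
    qed
    fix x y assume xy: "x \<in> K" "y \<in> K"
    have "L' * lam I * dist x y \<le> L * lam I * dist x y"
      using L pos by (intro mult_right_mono) auto
    with L'(2)[OF I xy] show le: "dist (word_map S I x) (word_map S I y) \<le> L * lam I * dist x y"
      by linarith
    also have "\<dots> \<le> L * lam I * diameter K"
      using L pos diameter_bounded_bound[OF bK xy] by (intro mult_left_mono) auto
    also have "\<dots> \<le> B * lam I" using pos by (simp add: B_def algebra_simps)
    finally show "dist (word_map S I x) (word_map S I y) \<le> B * lam I" .
    show "lam I * dist x y \<le> L * dist (word_map S I x) (word_map S I y)"
      using L'(3)[OF I xy] by (rule order_trans) (intro mult_right_mono L, simp)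
  next
    fix t p W assume "0 < t" "finite W" "W \<subseteq> lists {1..N}"
      "\<And>I. I \<in> W \<Longrightarrow> \<kappa> * t \<le> lam I \<and> lam I \<le> t \<and> word_map S I ` K \<inter> cball p (B * t) \<noteq> {}"
      "\<And>I J. I \<in> W \<Longrightarrow> J \<in> W \<Longrightarrow> I \<noteq> J \<Longrightarrow> \<not> prefix I J"
    then show "real (card W) \<le> Q" by (rule Q)
  qed (use L c \<kappa> B in auto)
  obtain m where m: "symbolic_gibbs_measure N S K m" and \<mu>: "\<mu> = distr m (restrict_space borel K) (coding_map S K)"
    using assms(4) unfolding is_gibbs_measure_def by blast
  define s where "s = hausdorff_dim K"
  obtain C where C: "1 \<le> C" "\<And>I. I \<in> lists {1..N} \<Longrightarrow> 
        (1 / C) * lam I powr s \<le> measure m (word_cylinder N I) \<and> measure m (word_cylinder N I) \<le> C * lam I powr s"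
    using m x0 unfolding symbolic_gibbs_measure_def lam_def s_def by blast
  have m': "prob_space m" "sets m = sets (stream_space (count_space {1..N}))"
    using m unfolding symbolic_gibbs_measure_def by auto
  interpret gibbs: gibbs_quasi_self_similar_set K N S lam L c \<kappa> B Q m s C
    by (intro gibbs_quasi_self_similar_set.intro gibbs_quasi_self_similar_set_axioms.intro quasi m' C)
       (use C in \<open>auto simp: field_simps\<close>)
  have "\<mu> = gibbs.\<mu>" by (simp add: \<mu> gibbs.\<mu>_def)
  then show ?thesis
    using gibbs.component_counting_if_maximal_power_law gibbs.maximal_power_law_if_component_counting by blast
qed

end
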